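(* For each integer $N>0$ and each $m\geq 2$, there are a sequence $\{(O^\ell,h^\ell)\}_{\ell\in\mathbb{N}}$ of $2m$-dimensional closed oriented Riemannian orbifolds with singular points, a closed oriented manifold $M$, and a sequence $g^\ell$ of Riemannian metrics on $M$ such that as $\ell\to\infty$, the spectra of $(O^\ell,h^\ell)$ and $(M,g^\ell)$ converge in the sense that for all $k=0,1,\dots,N$, $$\vert\lambda_k(O^\ell,h^\ell)-\lambda_k(M,g^\ell)\vert<1/\ell.$$ Moreover, the metrics $g^\ell$ converge pointwise to a smooth metric $g$ on the complement of a point in $M$.
   Context: Orbifolds are smooth; "with singular points" means that the set of singular points (points with nontrivial isotropy) is nonempty. $\lambda_k(O,g)$ denotes the $k$th eigenvalue of the Laplacian acting on functions on $(O,g)$: nonzero eigenvalues are listed in nondecreasing order with multiplicity with indices $k=1,2,\dots$, and the eigenvalue $0$ has index $0$. *)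

theory Defs
  imports "HOL-Analysis.Analysis" "HOL-Algebra.Bij" "HOL-Library.Function_Algebras"
begin

section \<open>Smooth maps between open subsets of Euclidean spaces\<close>

definition partial_deriv ::
  "'n::finite \<Rightarrow> (real^'n \<Rightarrow> 'b::real_normed_vector) \<Rightarrow> real^'n \<Rightarrow> 'b" where
  "partial_deriv i f x = frechet_derivative f (at x) (axis i 1)"

text \<open>Differentiability of class k; only meaningful on open sets.\<close>

primrec Ck_on ::
  "nat \<Rightarrow> (real^'n::finite) set \<Rightarrow> (real^'n \<Rightarrow> 'b::real_normed_vector) \<Rightarrow> bool" where
  "Ck_on 0 U f \<longleftrightarrow> continuous_on U f"
| "Ck_on (Suc k) U f \<longleftrightarrow> f differentiable_on U \<and> (\<forall>i. Ck_on k U (partial_deriv i f))"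

definition smooth_on ::
  "(real^'n::finite) set \<Rightarrow> (real^'n \<Rightarrow> 'b::real_normed_vector) \<Rightarrow> bool" where
  "smooth_on U f \<longleftrightarrow> (\<forall>k. Ck_on k U f)"

definition jacobian_matrix :: "(real^'n::finite \<Rightarrow> real^'n) \<Rightarrow> real^'n \<Rightarrow> real^'n^'n" where
  "jacobian_matrix f x = matrix (frechet_derivative f (at x))"


section \<open>Orbifolds\<close>

text \<open>
  An orbifold chart consists of a connected open set (\<open>cover\<close>), a finite group \<open>grp\<close> of
  diffeomorphisms of it, and a map \<open>proj\<close> to the underlying space inducing a homeomorphism
  of the orbit space onto an open set. As \<open>grp\<close> is a set of maps, its action is effective.
\<close>

record ('a, 'n) orb_chart =
  cover :: "(real^'n) set"
  grp :: "(real^'n \<Rightarrow> real^'n) set"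
  proj :: "real^'n \<Rightarrow> 'a"

definition chart_image :: "('a, 'n::finite) orb_chart \<Rightarrow> 'a set" where
  "chart_image c = proj c ` cover c"

definition orbifold_chart :: "'a topology \<Rightarrow> ('a, 'n::finite) orb_chart \<Rightarrow> bool" where
  "orbifold_chart X c \<longleftrightarrow>
     open (cover c) \<and> connected (cover c) \<and>
     finite (grp c) \<and> subgroup (grp c) (BijGroup (cover c)) \<and>
     (\<forall>\<gamma>\<in>grp c. smooth_on (cover c) \<gamma>) \<and>
     openin X (chart_image c) \<and>
     quotient_map (top_of_set (cover c)) (subtopology X (chart_image c)) (proj c) \<and>
     (\<forall>u\<in>cover c. \<forall>v\<in>cover c. proj c u = proj c v \<longleftrightarrow> (\<exists>\<gamma>\<in>grp c. v = \<gamma> u))"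

definition chart_embedding ::
  "('a, 'n::finite) orb_chart \<Rightarrow> ('a, 'n) orb_chart \<Rightarrow> (real^'n \<Rightarrow> real^'n) \<Rightarrow> bool" where
  "chart_embedding c d f \<longleftrightarrow>
     smooth_on (cover c) f \<and> inj_on f (cover c) \<and> f ` cover c \<subseteq> cover d \<and>
     (\<forall>u\<in>cover c. det (jacobian_matrix f u) \<noteq> 0) \<and>
     (\<forall>u\<in>cover c. proj d (f u) = proj c u)"

record ('a, 'n) orbifold =
  space_of :: "'a topology"
  atlas :: "('a, 'n) orb_chart set"

abbreviation points :: "('a, 'n::finite) orbifold \<Rightarrow> 'a set" where
  "points Q \<equiv> topspace (space_of Q)"

definition is_orbifold :: "('a, 'n::finite) orbifold \<Rightarrow> bool" where
  "is_orbifold Q \<longleftrightarrow>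
     Hausdorff_space (space_of Q) \<and> second_countable (space_of Q) \<and>
     (\<forall>c\<in>atlas Q. orbifold_chart (space_of Q) c) \<and>
     (\<Union>c\<in>atlas Q. chart_image c) = points Q \<and>
     (\<forall>c\<in>atlas Q. \<forall>d\<in>atlas Q. \<forall>x \<in> chart_image c \<inter> chart_image d.
        \<exists>e f g. orbifold_chart (space_of Q) e \<and> x \<in> chart_image e \<and>
                chart_embedding e c f \<and> chart_embedding e d g)"

text \<open>
  An orientation is encoded by an oriented atlas: the chart groups preserve the standard
  orientation of Euclidean space, and so do all changes of charts. A change of charts is a
  pair of embeddings of a common chart, which must both preserve or both reverse it.
\<close>

definition oriented :: "('a, 'n::finite) orbifold \<Rightarrow> bool" where
  "oriented Q \<longleftrightarrow>
     (\<forall>c\<in>atlas Q. \<forall>\<gamma>\<in>grp c. \<forall>u\<in>cover c. 0 < det (jacobian_matrix \<gamma> u)) \<and>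
     (\<forall>c\<in>atlas Q. \<forall>d\<in>atlas Q. \<forall>e f g.
        orbifold_chart (space_of Q) e \<longrightarrow> chart_embedding e c f \<longrightarrow> chart_embedding e d g \<longrightarrow>
        (\<forall>u\<in>cover e. 0 < det (jacobian_matrix f u) * det (jacobian_matrix g u)))"

text \<open>
  Closed means compact without boundary, and connected as usual in spectral geometry.
  Charts modelled on open sets of Euclidean space exclude boundary.
\<close>

definition closed_orbifold :: "('a, 'n::finite) orbifold \<Rightarrow> bool" where
  "closed_orbifold Q \<longleftrightarrow>
     is_orbifold Q \<and> compact_space (space_of Q) \<and> connected_space (space_of Q)"

text \<open>
  A manifold is an orbifold whose chart groups are all trivial: then each \<open>proj\<close> is a
  homeomorphism onto an open set, i.e. the inverse of a coordinate chart in the usual sense.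
\<close>

definition is_manifold :: "('a, 'n::finite) orbifold \<Rightarrow> bool" where
  "is_manifold Q \<longleftrightarrow>
     is_orbifold Q \<and> (\<forall>c\<in>atlas Q. grp c = {\<one>\<^bsub>BijGroup (cover c)\<^esub>})"

definition isotropy :: "('a, 'n::finite) orb_chart \<Rightarrow> real^'n \<Rightarrow> (real^'n \<Rightarrow> real^'n) set" where
  "isotropy c u = {\<gamma> \<in> grp c. \<gamma> u = u}"

definition singular_points :: "('a, 'n::finite) orbifold \<Rightarrow> 'a set" where
  "singular_points Q =
     {x. \<exists>c\<in>atlas Q. \<exists>u\<in>cover c. x = proj c u \<and> isotropy c u \<noteq> {\<one>\<^bsub>BijGroup (cover c)\<^esub>}}"


section \<open>Riemannian metrics\<close>

text \<open>A metric is given by its matrix of coefficients in each chart of the atlas.\<close>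

type_synonym ('a, 'n) metric = "('a, 'n) orb_chart \<Rightarrow> real^'n \<Rightarrow> real^'n^'n"

text \<open>
  The last condition says that the local metrics agree under changes of charts. For
  \<open>d = c\<close>, \<open>e = c\<close>, \<open>f\<close> the identity and \<open>k\<close> an element of \<open>grp c\<close>, it is the invariance of
  the local metric under the chart group.
\<close>

definition riemannian_metric_on ::
  "('a, 'n::finite) orbifold \<Rightarrow> 'a set \<Rightarrow> ('a, 'n) metric \<Rightarrow> bool" where
  "riemannian_metric_on Q S g \<longleftrightarrow>
     (\<forall>c\<in>atlas Q.
        smooth_on {u \<in> cover c. proj c u \<in> S} (g c) \<and>
        (\<forall>u\<in>cover c. proj c u \<in> S \<longrightarrow>
           transpose (g c u) = g c u \<and> (\<forall>v. v \<noteq> 0 \<longrightarrow> 0 < v \<bullet> (g c u *v v)))) \<and>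
     (\<forall>c\<in>atlas Q. \<forall>d\<in>atlas Q. \<forall>e f k.
        orbifold_chart (space_of Q) e \<longrightarrow> chart_embedding e c f \<longrightarrow> chart_embedding e d k \<longrightarrow>
        (\<forall>u\<in>cover e. proj e u \<in> S \<longrightarrow>
           transpose (jacobian_matrix f u) ** g c (f u) ** jacobian_matrix f u =
           transpose (jacobian_matrix k u) ** g d (k u) ** jacobian_matrix k u))"

abbreviation riemannian_metric :: "('a, 'n::finite) orbifold \<Rightarrow> ('a, 'n) metric \<Rightarrow> bool" where
  "riemannian_metric Q g \<equiv> riemannian_metric_on Q (points Q) g"


section \<open>The Laplace spectrum\<close>

text \<open>The Laplacian in local coordinates, with the sign making it nonnegative.\<close>

definition local_laplacian ::
  "(real^'n::finite \<Rightarrow> real^'n^'n) \<Rightarrow> (real^'n \<Rightarrow> real) \<Rightarrow> real^'n \<Rightarrow> real" where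
  "local_laplacian G f u =
     - (1 / sqrt (det (G u))) *
       (\<Sum>i\<in>UNIV. \<Sum>j\<in>UNIV.
          partial_deriv i (\<lambda>v. sqrt (det (G v)) * matrix_inv (G v) $ i $ j * partial_deriv j f v) u)"

text \<open>
  Smooth functions on an orbifold are those whose lifts to all charts are smooth. Functions
  vanish off the underlying set, so that distinct elements of the eigenspace are distinct
  functions on the orbifold.
\<close>

definition eigenspace ::
  "('a, 'n::finite) orbifold \<Rightarrow> ('a, 'n) metric \<Rightarrow> real \<Rightarrow> ('a \<Rightarrow> real) set" where
  "eigenspace Q g \<mu> =
     {\<phi>. (\<forall>x. x \<notin> points Q \<longrightarrow> \<phi> x = 0) \<and>
         (\<forall>c\<in>atlas Q. smooth_on (cover c) (\<phi> \<circ> proj c) \<and>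
            (\<forall>u\<in>cover c. local_laplacian (g c) (\<phi> \<circ> proj c) u = \<mu> * \<phi> (proj c u)))}"

abbreviation scale_fun :: "real \<Rightarrow> ('a \<Rightarrow> real) \<Rightarrow> 'a \<Rightarrow> real" where
  "scale_fun a \<phi> \<equiv> \<lambda>x. a * \<phi> x"

lemma vector_space_scale_fun: "vector_space (scale_fun :: real \<Rightarrow> ('a \<Rightarrow> real) \<Rightarrow> 'a \<Rightarrow> real)"
  by unfold_locales (auto simp: fun_eq_iff algebra_simps)

text \<open>
  The sequence lists the nonzero eigenvalues in nondecreasing order with multiplicity from
  index 1 on, and has 0 at index 0. A number that is not an eigenvalue has eigenspace of
  dimension 0 and does not occur. On a closed Riemannian orbifold all eigenspaces are
  finite-dimensional, so \<open>dim\<close> is the actual dimension, and such a sequence exists.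
\<close>

definition eigenvalue_sequence ::
  "('a, 'n::finite) orbifold \<Rightarrow> ('a, 'n) metric \<Rightarrow> (nat \<Rightarrow> real) \<Rightarrow> bool" where
  "eigenvalue_sequence Q g \<Lambda> \<longleftrightarrow>
     mono \<Lambda> \<and> \<Lambda> 0 = 0 \<and> (\<forall>k\<ge>1. \<Lambda> k \<noteq> 0) \<and>
     (\<forall>\<mu>. \<mu> \<noteq> 0 \<longrightarrow>
        finite {k. 1 \<le> k \<and> \<Lambda> k = \<mu>} \<and>
        card {k. 1 \<le> k \<and> \<Lambda> k = \<mu>} = vector_space.dim scale_fun (eigenspace Q g \<mu>))"

definition eigenvalue ::
  "nat \<Rightarrow> ('a, 'n::finite) orbifold \<Rightarrow> ('a, 'n) metric \<Rightarrow> real" where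
  "eigenvalue k Q g = (THE \<Lambda>. eigenvalue_sequence Q g \<Lambda>) k"

lemma eigenvalue_sequence_unique:
  assumes A: "eigenvalue_sequence Q g a" and B: "eigenvalue_sequence Q g b"
  shows "a = b"
proof -
  have le: "\<not> a k < b k" if A: "eigenvalue_sequence Q g a" and B: "eigenvalue_sequence Q g b"
    and eq: "\<And>j. j < k \<Longrightarrow> a j = b j" for a b k
  proof
    assume lt: "a k < b k"
    have k: "1 \<le> k" using A B lt unfolding eigenvalue_sequence_def by (cases k) auto
    define \<mu> where "\<mu> = a k"
    let ?A = "{j. 1 \<le> j \<and> a j = \<mu>}" and ?B = "{j. 1 \<le> j \<and> b j = \<mu>}"
    have \<mu>: "\<mu> \<noteq> 0" using A k unfolding eigenvalue_sequence_def \<mu>_def by auto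
    have fin: "finite ?A" and card: "card ?A = card ?B"
      using A B \<mu> unfolding eigenvalue_sequence_def by auto
    have "j < k" if "b j = \<mu>" for j
    proof (rule ccontr)
      assume "\<not> j < k"
      then have "b k \<le> b j" using B unfolding eigenvalue_sequence_def by (simp add: monoD)
      with lt that \<mu>_def show False by simp
    qed
    then have "?B \<subseteq> ?A - {k}" using eq by auto
    moreover have "k \<in> ?A" using k \<mu>_def by simp
    ultimately have "?B \<subset> ?A" by blast
    then have "card ?B < card ?A" by (rule psubset_card_mono[OF fin])
    then show False using card by linarith
  qed
  have "a k = b k" for k
  proof (induction k rule: less_induct)
    case (less k)
    show ?case using le[OF A B, of k] le[OF B A, of k] less by force
  qed
  then show ?thesis by blast
qed

lemma eigenvalue_eq: "eigenvalue_sequence Q g \<Lambda> \<Longrightarrow> eigenvalue k Q g = \<Lambda> k"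
  unfolding eigenvalue_def by (metis eigenvalue_sequence_unique the_equality)

end

theory Submission
  imports Defs
begin

text \<open>All metrics can be flat and all sequences constant. Let \<open>T\<close> be the torus \<open>\<real>\<^sup>n / 2\<pi>\<int>\<^sup>n\<close> with the constant
metric in which one circle factor has length \<open>2\<pi>\<close> and the others are so short that every
eigenvalue up to \<open>N\<^sup>2\<close> comes from functions of the long coordinate alone. Let \<open>O\<close> be the quotient of
\<open>T\<close> by the half turn that reverses two of the short coordinates. The half turn preserves the
orientation and has fixed points, so \<open>O\<close> is oriented and singular, of the form (circle) \<times>
(pillow) \<times> (torus). Functions on \<open>O\<close> are the invariant functions on \<open>T\<close>, and functions of the long
coordinate are invariant; so both spectra begin with \<open>0, 1, 1, 4, 4, 9, 9, \<dots>\<close> and agree at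
least up to index \<open>N\<close>. The metrics on \<open>T\<close> form a constant sequence, which converges
everywhere.

Three points carry the proof.

The spectrum. An eigenfunction lifts to a periodic function on \<open>\<real>\<^sup>n\<close>, and such a function is a
finite combination of the characters with the right value of the quadratic form of the metric
(\<open>fourier_expansion\<close>). This needs that the characters are complete (\<open>fourier_complete\<close>, by
Stone--Weierstrass) and integration by parts over a period box
(\<open>integral_partial_derivative_period_box\<close>, by Fubini). It gives finite-dimensional eigenspaces and
a discrete spectrum, hence an eigenvalue sequence (\<open>eigenvalue_sequence_spectral_list\<close>); and it
shows that the eigenspaces for eigenvalues up to \<open>N\<^sup>2\<close> are isomorphic
(\<open>dim_eigenspace_eq_torus\<close>).

The orbifold structure. Both spaces are quotients of \<open>\<real>\<^sup>n\<close> by translations of the lattice combined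
with sign changes of coordinates, and are treated together in the locale \<open>flat_orbifold\<close>. Charts are
balls so small that only elements fixing the centre identify two of their points.

Orientation and invariance of the metric concern arbitrary smooth embeddings into charts, not only
the evident affine ones. Two embeddings \<open>f\<close>, \<open>g\<close> of the same chart satisfy \<open>g x = \<gamma> (f x)\<close> with a group
element \<open>\<gamma>\<close> depending on \<open>x\<close>; by Baire's theorem \<open>\<gamma>\<close> is locally constant on a dense open set,
and closed relations between the Jacobians extend to all points (\<open>jacobian_closed_relation\<close>).\<close>

section \<open>Listing a discrete spectrum\<close>

text \<open>The counting function of a spectrum in which \<open>\<mu>\<close> has multiplicity \<open>d \<mu>\<close>.\<close>

definition spectral_count :: "(real \<Rightarrow> nat) \<Rightarrow> real \<Rightarrow> nat" where
  "spectral_count d C = (\<Sum>\<mu>\<in>{\<mu>. 0 < \<mu> \<and> \<mu> \<le> C \<and> d \<mu> \<noteq> 0}. d \<mu>)"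

text \<open>The generalised inverse of the counting function lists the spectrum with multiplicity.\<close>

definition spectral_list :: "(real \<Rightarrow> nat) \<Rightarrow> nat \<Rightarrow> real" where
  "spectral_list d k = (if k = 0 then 0 else LEAST \<mu>. 0 < \<mu> \<and> k \<le> spectral_count d \<mu>)"

context
  fixes d :: "real \<Rightarrow> nat"
  assumes discrete: "\<And>C. finite {\<mu>. 0 < \<mu> \<and> \<mu> \<le> C \<and> d \<mu> \<noteq> 0}"
    and unbounded: "\<And>k. \<exists>C. k \<le> spectral_count d C"
begin

lemma spectral_count_mono: "C \<le> C' \<Longrightarrow> spectral_count d C \<le> spectral_count d C'"
  unfolding spectral_count_def by (rule sum_mono2[OF discrete]) auto

lemma spectral_count_below:
  assumes "1 \<le> k" and "0 < \<mu>"
  shows "(\<exists>\<nu>>0. \<nu> < \<mu> \<and> k \<le> spectral_count d \<nu>) \<longleftrightarrow>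
         k \<le> (\<Sum>\<nu>\<in>{\<nu>. 0 < \<nu> \<and> \<nu> < \<mu> \<and> d \<nu> \<noteq> 0}. d \<nu>)" (is "?L \<longleftrightarrow> k \<le> sum d ?B")
proof
  have fin: "finite ?B" by (rule finite_subset[OF _ discrete[of \<mu>]]) auto
  show "k \<le> sum d ?B" if ?L
  proof -
    from that obtain \<nu> where "\<nu> < \<mu>" "k \<le> spectral_count d \<nu>" by blast
    moreover have "spectral_count d \<nu> \<le> sum d ?B"
      unfolding spectral_count_def using \<open>\<nu> < \<mu>\<close> by (intro sum_mono2[OF fin]) auto
    ultimately show ?thesis by simp
  qed
  show ?L if k: "k \<le> sum d ?B"
  proof -
    have "?B \<noteq> {}" using k assms by (intro notI) simp
    then have M: "Max ?B \<in> ?B" using fin Max_in by blast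
    have "?B = {\<nu>. 0 < \<nu> \<and> \<nu> \<le> Max ?B \<and> d \<nu> \<noteq> 0}"
    proof (intro equalityI subsetI)
      fix x assume "x \<in> ?B"
      then show "x \<in> {\<nu>. 0 < \<nu> \<and> \<nu> \<le> Max ?B \<and> d \<nu> \<noteq> 0}" using Max_ge[OF fin, of x] by simp
    next
      fix x assume "x \<in> {\<nu>. 0 < \<nu> \<and> \<nu> \<le> Max ?B \<and> d \<nu> \<noteq> 0}"
      then show "x \<in> ?B" using M by auto
    qed
    then have "spectral_count d (Max ?B) = sum d ?B" unfolding spectral_count_def by simp
    then show ?thesis using M k by auto
  qed
qed

text \<open>The minimum exists since the counting function is a step function that jumps exactly at
  the points of the spectrum.\<close>

lemma spectral_list_le_iff:
  assumes k: "1 \<le> k"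
  shows "0 < spectral_list d k" and "0 < \<mu> \<Longrightarrow> spectral_list d k \<le> \<mu> \<longleftrightarrow> k \<le> spectral_count d \<mu>"
proof -
  let ?P = "\<lambda>\<mu>. 0 < \<mu> \<and> k \<le> spectral_count d \<mu>"
  obtain C where C: "k \<le> spectral_count d C" using unbounded by blast
  let ?A = "{\<mu>. 0 < \<mu> \<and> \<mu> \<le> C \<and> d \<mu> \<noteq> 0} \<inter> {\<mu>. ?P \<mu>}"
  have fin: "finite ?A" using discrete by blast
  have step: "\<exists>\<nu>\<in>?A. \<nu> \<le> \<mu>" if P: "?P \<mu>" and "\<mu> \<le> C" for \<mu>
  proof -
    let ?D = "{\<nu>. 0 < \<nu> \<and> \<nu> \<le> \<mu> \<and> d \<nu> \<noteq> 0}"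
    have "?D \<noteq> {}" using P k unfolding spectral_count_def by (intro notI) simp
    then have M: "Max ?D \<in> ?D" using discrete Max_in by blast
    have "{\<nu>. 0 < \<nu> \<and> \<nu> \<le> Max ?D \<and> d \<nu> \<noteq> 0} = ?D"
    proof (intro equalityI subsetI)
      fix x assume "x \<in> ?D"
      then show "x \<in> {\<nu>. 0 < \<nu> \<and> \<nu> \<le> Max ?D \<and> d \<nu> \<noteq> 0}" using Max_ge[OF discrete, of x \<mu>] by simp
    qed (use M in auto)
    then have "spectral_count d (Max ?D) = spectral_count d \<mu>"
      unfolding spectral_count_def by simp
    then show ?thesis using M P \<open>\<mu> \<le> C\<close> by (intro bexI[of _ "Max ?D"]) auto
  qed
  have "C > 0"
  proof (rule ccontr)
    assume "\<not> 0 < C"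
    then have "{\<mu>. 0 < \<mu> \<and> \<mu> \<le> C \<and> d \<mu> \<noteq> 0} = {}" by auto
    then have "spectral_count d C = 0" unfolding spectral_count_def by simp
    then show False using C k by simp
  qed
  then have ne: "?A \<noteq> {}" using step[of C] C by blast
  have L: "(LEAST \<mu>. ?P \<mu>) = Min ?A"
  proof (rule Least_equality)
    show "?P (Min ?A)" using Min_in[OF fin ne] by auto
    fix y assume "?P y"
    show "Min ?A \<le> y"
    proof (cases "y \<le> C")
      case True
      then show ?thesis using step[OF \<open>?P y\<close>] Min_le[OF fin] order_trans by blast
    next
      case False
      then show ?thesis using Min_in[OF fin ne] by auto
    qed
  qed
  have eq: "spectral_list d k = Min ?A" using L k unfolding spectral_list_def by simp
  have mem: "?P (spectral_list d k)" using Min_in[OF fin ne] unfolding eq by auto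
  then show "0 < spectral_list d k" by simp
  show "spectral_list d k \<le> \<mu> \<longleftrightarrow> k \<le> spectral_count d \<mu>" if "0 < \<mu>"
  proof
    assume "spectral_list d k \<le> \<mu>"
    then show "k \<le> spectral_count d \<mu>" using mem spectral_count_mono order_trans by blast
  next
    assume "k \<le> spectral_count d \<mu>"
    show "spectral_list d k \<le> \<mu>"
    proof (cases "\<mu> \<le> C")
      case True
      then show ?thesis using step[of \<mu>] \<open>k \<le> spectral_count d \<mu>\<close> that Min_le[OF fin] eq order_trans
        by (metis (no_types, lifting))
    next
      case False
      then show ?thesis using Min_in[OF fin ne] unfolding eq by auto
    qed
  qed
qed

text \<open>The indices \<open>k\<close> with value \<open>\<mu>\<close> are those between the left limit of the counting function at \<open>\<mu>\<close> and
  its value there, and the difference of the two is the jump \<open>d \<mu>\<close>.\<close>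

lemma spectral_list_multiplicity:
  assumes \<mu>: "0 < \<mu>"
  shows "finite {k. 1 \<le> k \<and> spectral_list d k = \<mu>}"
    and "card {k. 1 \<le> k \<and> spectral_list d k = \<mu>} = d \<mu>"
proof -
  let ?A = "{\<nu>. 0 < \<nu> \<and> \<nu> \<le> \<mu> \<and> d \<nu> \<noteq> 0}" and ?B = "{\<nu>. 0 < \<nu> \<and> \<nu> < \<mu> \<and> d \<nu> \<noteq> 0}"
  have lt: "spectral_list d k < \<mu> \<longleftrightarrow> k \<le> sum d ?B" if k: "1 \<le> k" for k
  proof -
    have "spectral_list d k < \<mu> \<longleftrightarrow> (\<exists>\<nu>>0. \<nu> < \<mu> \<and> k \<le> spectral_count d \<nu>)"
      using spectral_list_le_iff[OF k] by (metis order_le_less_trans order_refl)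
    then show ?thesis using spectral_count_below[OF k \<mu>] by simp
  qed
  have S: "{k. 1 \<le> k \<and> spectral_list d k = \<mu>} = {sum d ?B<..sum d ?A}" (is "?S = _")
  proof (intro equalityI subsetI)
    fix k assume "k \<in> ?S"
    then show "k \<in> {sum d ?B<..sum d ?A}"
      using lt[of k] spectral_list_le_iff(2)[of k \<mu>] \<mu> unfolding spectral_count_def by auto
  next
    fix k assume k: "k \<in> {sum d ?B<..sum d ?A}"
    then have "1 \<le> k" by auto
    then show "k \<in> ?S"
      using lt[of k] spectral_list_le_iff(2)[of k \<mu>] \<mu> k unfolding spectral_count_def by auto
  qed
  have "x < \<mu>" if "x \<le> \<mu>" "d x \<noteq> 0" "d \<mu> = 0" for x
    using that by (cases "x = \<mu>") auto
  then have "?A = ?B \<union> (if d \<mu> \<noteq> 0 then {\<mu>} else {})" using \<mu> by auto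
  then have "sum d ?A = sum d ?B + d \<mu>"
    using finite_subset[OF _ discrete[of \<mu>], of ?B] by (auto simp: sum.union_disjoint)
  then show "finite ?S" "card ?S = d \<mu>" unfolding S by auto
qed

end

lemma eigenvalue_sequence_spectral_list:
  fixes Q :: "('a, 'n::finite) orbifold" and g :: "('a, 'n) metric"
  defines "d \<equiv> \<lambda>\<mu>. vector_space.dim scale_fun (eigenspace Q g \<mu>)"
  assumes neg: "\<And>\<mu>. \<mu> < 0 \<Longrightarrow> d \<mu> = 0"
    and discrete: "\<And>C. finite {\<mu>. 0 < \<mu> \<and> \<mu> \<le> C \<and> d \<mu> \<noteq> 0}"
    and unbounded: "\<And>k. \<exists>C. k \<le> spectral_count d C"
  shows "eigenvalue_sequence Q g (spectral_list d)"
  unfolding eigenvalue_sequence_def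
proof (intro conjI allI impI)
  note pos = spectral_list_le_iff(1)[OF discrete unbounded]
    and le = spectral_list_le_iff(2)[OF discrete unbounded]
  show "mono (spectral_list d)"
  proof (rule monoI)
    fix j k :: nat assume jk: "j \<le> k"
    show "spectral_list d j \<le> spectral_list d k"
    proof (cases "j = 0")
      case True
      then show ?thesis using pos[of k] by (cases "k = 0") (auto simp: spectral_list_def)
    next
      case False
      then have "k \<le> spectral_count d (spectral_list d k)" using le[of k] pos[of k] jk by auto
      then show ?thesis using le[of j] pos[of k] False jk by auto
    qed
  qed
  show "spectral_list d 0 = 0" by (simp add: spectral_list_def)
  show "spectral_list d k \<noteq> 0" if "1 \<le> k" for k using pos[OF that] by simp
  fix \<mu> :: real assume \<mu>: "\<mu> \<noteq> 0"
  have "finite {k. 1 \<le> k \<and> spectral_list d k = \<mu>} \<and> card {k. 1 \<le> k \<and> spectral_list d k = \<mu>} = d \<mu>"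
  proof (cases "\<mu> > 0")
    case True
    then show ?thesis using spectral_list_multiplicity[OF discrete unbounded True] by simp
  next
    case False
    then have "{k. 1 \<le> k \<and> spectral_list d k = \<mu>} = {}" using pos by force
    moreover have "d \<mu> = 0" using neg False \<mu> by simp
    ultimately show ?thesis by (metis card.empty finite.emptyI)
  qed
  then show "finite {k. 1 \<le> k \<and> spectral_list d k = \<mu>}"
    and "card {k. 1 \<le> k \<and> spectral_list d k = \<mu>} = vector_space.dim scale_fun (eigenspace Q g \<mu>)"
    unfolding d_def by auto
qed

text \<open>The first entries of the list depend only on the lower part of the spectrum. This is how the two
  spaces are compared.\<close>

lemma spectral_list_cong:
  assumes eq: "\<And>\<mu>. 0 < \<mu> \<Longrightarrow> \<mu> \<le> C \<Longrightarrow> d \<mu> = d' \<mu>"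
    and discrete: "\<And>C. finite {\<mu>. 0 < \<mu> \<and> \<mu> \<le> C \<and> d \<mu> \<noteq> 0}"
      "\<And>C. finite {\<mu>. 0 < \<mu> \<and> \<mu> \<le> C \<and> d' \<mu> \<noteq> 0}"
    and unbounded: "\<And>k. \<exists>C. k \<le> spectral_count d C" "\<And>k. \<exists>C. k \<le> spectral_count d' C"
    and C: "0 < C" "k \<le> spectral_count d C"
  shows "spectral_list d k = spectral_list d' k"
proof (cases "k = 0")
  case False
  then have k: "1 \<le> k" by simp
  note le = spectral_list_le_iff[OF discrete(1) unbounded(1) k]
    and le' = spectral_list_le_iff[OF discrete(2) unbounded(2) k]
  have cnt: "spectral_count d \<mu> = spectral_count d' \<mu>" if "\<mu> \<le> C" for \<mu>
    unfolding spectral_count_def using that by (intro sum.cong) (auto simp: eq)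
  have "spectral_list d k \<le> C" using le C by simp
  moreover have "spectral_list d' k \<le> C" using le' C cnt by simp
  ultimately show ?thesis
    using le(2)[OF le(1)] le(2)[OF le'(1)] le'(2)[OF le(1)] le'(2)[OF le'(1)] cnt
    by (metis order_antisym order_refl)
qed (simp add: spectral_list_def)

section \<open>Periodic functions and compact quotients\<close>

abbreviation period_box :: "'a::euclidean_space set" where
  "period_box \<equiv> cbox 0 ((2 * pi) *\<^sub>R One)"

text \<open>By Fubini's theorem the integral in the direction of \<open>b\<close> can be taken first, and the fundamental theorem
  of calculus makes it a difference of two values of \<open>G\<close> that agree by periodicity.\<close>

lemma integral_partial_derivative_period_box:
  fixes G D :: "'a::euclidean_space \<Rightarrow> complex"
  assumes b: "b \<in> Basis"
    and G: "\<And>x. ((\<lambda>t. G (x + t *\<^sub>R b)) has_vector_derivative D x) (at 0)"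
    and D: "continuous_on UNIV D"
    and per: "\<And>x. G (x + (2 * pi) *\<^sub>R b) = G x"
  shows "integral period_box D = 0"
proof -
  define h :: "'a \<Rightarrow> complex" where "h x = indicator period_box x *\<^sub>R D x" for x
  have set_int: "set_integrable lborel period_box D"
    by (rule borel_integrable_compact[OF compact_cbox continuous_on_subset[OF D subset_UNIV], folded set_integrable_def])
  have int: "integrable lborel h"
    using set_int unfolding set_integrable_def h_def .
  let ?B = "Basis - {b}"
  let ?v = "\<lambda>f::'a \<Rightarrow> real. \<Sum>c\<in>Basis. f c *\<^sub>R c"
  interpret product_sigma_finite "\<lambda>_::'a. lborel :: real measure" ..
  have ins: "insert b ?B = Basis" using b by auto
  have meas: "?v \<in> measurable (Pi\<^sub>M Basis (\<lambda>_. lborel)) borel" by measurable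
  have hm: "h \<in> borel_measurable borel" using borel_measurable_integrable[OF int] by simp
  have intP: "integrable (Pi\<^sub>M Basis (\<lambda>_. lborel)) (\<lambda>f. h (?v f))"
    using int integrable_distr_eq[OF meas hm] by (simp add: lborel_eq[symmetric])
  have "integral period_box D = (LINT x|lborel. h x)"
    using set_borel_integral_eq_integral(2)[OF set_int] unfolding set_lebesgue_integral_def h_def by simp
  also have "\<dots> = (LINT f|Pi\<^sub>M Basis (\<lambda>_. lborel). h (?v f))"
    by (subst lborel_eq) (rule integral_distr[OF meas hm])
  also have "\<dots> = (LINT f|Pi\<^sub>M ?B (\<lambda>_. lborel). LINT y|lborel. h (?v (f(b := y))))"
    by (rule product_integral_insert[of ?B b "\<lambda>f. h (?v f)", unfolded ins, OF _ _ intP]) auto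
  also have "\<dots> = (LINT f|Pi\<^sub>M ?B (\<lambda>_. lborel :: real measure). 0)"
  proof (rule Bochner_Integration.integral_cong[OF refl])
    fix f :: "'a \<Rightarrow> real"
    define z where "z = (\<Sum>c\<in>?B. f c *\<^sub>R c)"
    have v: "?v (f(b := y)) = z + y *\<^sub>R b" for y
    proof -
      have "?v (f(b := y)) = y *\<^sub>R b + (\<Sum>c\<in>?B. (f(b := y)) c *\<^sub>R c)"
        using b by (subst sum.remove[of _ b]) auto
      also have "(\<Sum>c\<in>?B. (f(b := y)) c *\<^sub>R c) = z" unfolding z_def by (intro sum.cong) auto
      finally show ?thesis by (simp add: add.commute)
    qed
    have zb: "z \<bullet> c = (if c = b then 0 else f c)" if "c \<in> Basis" for c
    proof -
      have "z \<bullet> c = (\<Sum>c'\<in>?B. if c' = c then f c' else 0)"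
        unfolding z_def inner_sum_left using that by (intro sum.cong) (auto simp: inner_Basis)
      then show ?thesis using that by (auto simp: sum.delta)
    qed
    let ?P = "\<forall>c\<in>?B. 0 \<le> f c \<and> f c \<le> 2 * pi"
    \<comment> \<open>A line in direction \<open>b\<close> meets the box in a full period or not at all.\<close>
    have ind: "z + y *\<^sub>R b \<in> period_box \<longleftrightarrow> ?P \<and> y \<in> {0..2*pi}" for y
      using b zb by (auto simp: mem_box inner_add_left inner_Basis inner_sum_left)
    show "(LINT y|lborel. h (?v (f(b := y)))) = 0"
    proof (cases ?P)
      case True
      have der: "((\<lambda>t. G (z + t *\<^sub>R b)) has_vector_derivative D (z + y *\<^sub>R b)) (at y)" for y
      proof -
        have "((\<lambda>t. G ((z + y *\<^sub>R b) + t *\<^sub>R b)) \<circ> (\<lambda>t. t - y) has_vector_derivative (1 *\<^sub>R D (z + y *\<^sub>R b))) (at y)"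
          by (rule vector_diff_chain_at) (use G[of "z + y *\<^sub>R b"] in \<open>auto intro!: derivative_eq_intros\<close>)
        then show ?thesis by (simp add: o_def algebra_simps)
      qed
      have cont: "continuous_on {0..2*pi} (\<lambda>y. D (z + y *\<^sub>R b))"
        by (intro continuous_on_compose2[OF D] continuous_intros) auto
      have "(LINT y|lborel. h (?v (f(b := y)))) = (LINT y|lborel. indicator {0..2*pi} y *\<^sub>R D (z + y *\<^sub>R b))"
        unfolding h_def v using True ind by (intro Bochner_Integration.integral_cong) (auto simp: indicator_def)
      also have "\<dots> = G (z + (2*pi) *\<^sub>R b) - G (z + 0 *\<^sub>R b)"
        using integral_FTC_atLeastAtMost[of 0 "2*pi" "\<lambda>t. G (z + t *\<^sub>R b)" "\<lambda>y. D (z + y *\<^sub>R b)"] cont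
          has_vector_derivative_at_within[OF der] by simp
      also have "\<dots> = 0" using per[of z] by simp
      finally show ?thesis .
    next
      case False
      then have "h (?v (f(b := y))) = 0" for y unfolding h_def v using ind by (simp add: indicator_def)
      then show ?thesis by simp
    qed
  qed
  finally show ?thesis by simp
qed

text \<open>A continuous map that is onto its range already from a compact set is a quotient map, since the
  image of a saturated closed set is the image of its compact part.\<close>

lemma compact_cover_continuous_factor:
  fixes E :: "'a::topological_space \<Rightarrow> 'b::t2_space" and g :: "'a \<Rightarrow> 'c::topological_space"
  assumes E: "continuous_on UNIV E" and K: "compact K" "E ` K = range E"
    and g: "continuous_on UNIV g" and fib: "\<And>x y. E x = E y \<Longrightarrow> g x = g y"
  obtains G where "continuous_on (range E) G" "\<And>x. G (E x) = g x"
proof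
  define G where "G z = g (inv_into UNIV E z)" for z
  show GE: "G (E x) = g x" for x unfolding G_def by (rule fib) (simp add: f_inv_into_f)
  show "continuous_on (range E) G"
    unfolding continuous_on_closed_invariant
  proof (intro allI impI)
    fix B :: "'c set" assume "closed B"
    then have "closed (g -` B)" using g continuous_on_closed_vimage[of UNIV g] by simp
    then have "compact (K \<inter> g -` B)" using K(1) by (rule compact_Int_closed[rotated])
    then have "compact (E ` (K \<inter> g -` B))"
      using E by (intro compact_continuous_image) (auto intro: continuous_on_subset)
    then have "closed (E ` (K \<inter> g -` B))" by (rule compact_imp_closed)
    moreover have "E ` (K \<inter> g -` B) \<inter> range E = G -` B \<inter> range E"
    proof
      show "G -` B \<inter> range E \<subseteq> E ` (K \<inter> g -` B) \<inter> range E"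
      proof
        fix z assume z: "z \<in> G -` B \<inter> range E"
        then obtain x where "x \<in> K" "z = E x" using K(2) by (metis IntD2 imageE)
        then show "z \<in> E ` (K \<inter> g -` B) \<inter> range E" using z GE by auto
      qed
    qed (use GE in auto)
    ultimately show "\<exists>A. closed A \<and> A \<inter> range E = G -` B \<inter> range E" by blast
  qed
qed

section \<open>Completeness of the characters of the torus\<close>

definition int_lattice :: "(real^'n::finite) set" where
  "int_lattice = {v. \<forall>i. v $ i \<in> \<int>}"

definition periodic :: "(real^'n::finite \<Rightarrow> 'b) \<Rightarrow> bool" where
  "periodic F \<longleftrightarrow> (\<forall>x i. F (x + (2 * pi) *\<^sub>R axis i 1) = F x)"

definition character :: "real^'n::finite \<Rightarrow> real^'n \<Rightarrow> complex" where
  "character k x = cis (k \<bullet> x)"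

text \<open>The embedding of the torus \<open>\<real>\<^sup>n / 2\<pi>\<int>\<^sup>n\<close> as a product of unit circles.\<close>

definition torus_map :: "real^'n::finite \<Rightarrow> complex^'n" where
  "torus_map x = (\<chi> i. cis (x $ i))"

lemma int_lattice_add: "k \<in> int_lattice \<Longrightarrow> l \<in> int_lattice \<Longrightarrow> k + l \<in> int_lattice"
  and int_lattice_minus: "k \<in> int_lattice \<Longrightarrow> - k \<in> int_lattice"
  and int_lattice_0: "0 \<in> int_lattice"
  and int_lattice_axis: "axis i 1 \<in> int_lattice"
  by (auto simp: int_lattice_def axis_def)

lemma periodic_int_lattice:
  assumes per: "periodic F" and v: "v \<in> int_lattice"
  shows "F (x + (2 * pi) *\<^sub>R v) = F x"
proof -
  have step: "F (x + (2 * pi * of_int n) *\<^sub>R axis i 1) = F x" for x i and n :: int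
  proof (induction n rule: int_induct[of _ 0])
    case (step1 n)
    then show ?case using per[unfolded periodic_def, rule_format, of "x + (2 * pi * of_int n) *\<^sub>R axis i 1" i]
      by (simp add: algebra_simps)
  next
    case (step2 n)
    then show ?case
      using per[unfolded periodic_def, rule_format, of "x + (2 * pi * of_int (n - 1)) *\<^sub>R axis i 1" i]
      by (simp add: algebra_simps)
  qed simp
  have "F (x + (\<Sum>i\<in>S. (2 * pi * v $ i) *\<^sub>R axis i 1)) = F x" if "finite S" for S
    using that
  proof (induction S)
    case (insert i S)
    obtain n where "v $ i = of_int n" using v unfolding int_lattice_def by (auto elim: Ints_cases)
    then show ?case
      using insert step[of "x + (\<Sum>i\<in>S. (2 * pi * v $ i) *\<^sub>R axis i 1)" n i]
      by (simp add: algebra_simps)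
  qed simp
  moreover have "(\<Sum>i\<in>UNIV. (2 * pi * v $ i) *\<^sub>R axis i 1) = (2 * pi) *\<^sub>R v"
    by (simp add: vec_eq_iff axis_def if_distrib cong: if_cong)
  ultimately show ?thesis using finite[of UNIV] by metis
qed

lemma torus_map_eq_iff: "torus_map x = torus_map y \<longleftrightarrow> (\<exists>v\<in>int_lattice. y = x + (2 * pi) *\<^sub>R v)"
proof
  assume eq: "torus_map x = torus_map y"
  have "\<exists>n::int. y $ i = x $ i + 2 * pi * n" for i
  proof -
    have "cis (x $ i) = cis (y $ i)" using eq unfolding torus_map_def by (simp add: vec_eq_iff)
    then have "cos (y $ i) = cos (x $ i) \<and> sin (y $ i) = sin (x $ i)" by (simp add: complex_eq_iff)
    then show ?thesis using sin_cos_eq_iff[of "y $ i" "x $ i"] by auto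
  qed
  then obtain n :: "'a \<Rightarrow> int" where "\<And>i. y $ i = x $ i + 2 * pi * n i" by metis
  then show "\<exists>v\<in>int_lattice. y = x + (2 * pi) *\<^sub>R v"
    by (intro bexI[of _ "\<chi> i. of_int (n i)"]) (auto simp: vec_eq_iff int_lattice_def)
next
  assume "\<exists>v\<in>int_lattice. y = x + (2 * pi) *\<^sub>R v"
  then obtain v where v: "v \<in> int_lattice" "y = x + (2 * pi) *\<^sub>R v" by blast
  have "cis (y $ i) = cis (x $ i)" for i
  proof -
    obtain n where "v $ i = of_int n" using v(1) unfolding int_lattice_def by (auto elim: Ints_cases)
    then have "\<exists>n::int. y $ i = x $ i + 2 * pi * n" using v(2) by auto
    then show ?thesis using sin_cos_eq_iff[of "y $ i" "x $ i"] by (auto simp: complex_eq_iff)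
  qed
  then show "torus_map x = torus_map y" by (simp add: torus_map_def vec_eq_iff)
qed

lemma periodic_torus_map: "periodic F \<Longrightarrow> torus_map x = torus_map y \<Longrightarrow> F x = F y"
  unfolding torus_map_eq_iff using periodic_int_lattice by metis

lemma period_box_translate: "\<exists>v\<in>int_lattice. x + (2 * pi) *\<^sub>R v \<in> (period_box :: (real^'n::finite) set)"
proof
  let ?v = "\<chi> i. - real_of_int \<lfloor>x $ i / (2 * pi)\<rfloor>"
  show "?v \<in> int_lattice" by (simp add: int_lattice_def)
  have "0 \<le> x $ i - 2 * pi * of_int \<lfloor>x $ i / (2 * pi)\<rfloor> \<and>
        x $ i - 2 * pi * of_int \<lfloor>x $ i / (2 * pi)\<rfloor> \<le> 2 * pi" for i
    using floor_divide_lower[of "2 * pi" "x $ i"] floor_divide_upper[of "2 * pi" "x $ i"]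
    by (simp add: algebra_simps)
  moreover have "One $ i = (1::real)" for i :: 'n
    by (simp add: cart_eq_inner_axis inner_sum_left inner_Basis axis_in_Basis_iff)
  ultimately show "x + (2 * pi) *\<^sub>R ?v \<in> period_box"
    by (simp add: mem_box_cart)
qed

lemma continuous_torus_map: "continuous_on A torus_map"
  unfolding torus_map_def cis_conv_exp by (intro continuous_intros)

lemma torus_map_period_box: "torus_map ` period_box = range torus_map"
proof
  show "range torus_map \<subseteq> torus_map ` period_box"
  proof
    fix z :: "complex^'n" assume "z \<in> range torus_map"
    then obtain x where "z = torus_map x" by blast
    moreover obtain v where v: "v \<in> int_lattice" "x + (2 * pi) *\<^sub>R v \<in> period_box"
      using period_box_translate by blast
    moreover have "torus_map x = torus_map (x + (2 * pi) *\<^sub>R v)" using v torus_map_eq_iff by blast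
    ultimately show "z \<in> torus_map ` period_box" by blast
  qed
qed auto

text \<open>Trigonometric polynomials; they are an algebra because characters multiply to characters.\<close>

inductive trig_poly :: "(real^'n::finite \<Rightarrow> complex) \<Rightarrow> bool" where
  monomial: "k \<in> int_lattice \<Longrightarrow> trig_poly (\<lambda>x. c * character k x)"
| add: "trig_poly f \<Longrightarrow> trig_poly g \<Longrightarrow> trig_poly (\<lambda>x. f x + g x)"

lemma character_mult: "character k x * character l x = character (k + l) x"
  by (simp add: character_def cis_mult inner_add_left)

lemma [continuous_intros]: "continuous_on A (character k)"
  unfolding character_def cis_conv_exp by (intro continuous_intros)

lemma periodic_character: "k \<in> int_lattice \<Longrightarrow> periodic (character k)"
proof -
  assume "k \<in> int_lattice"
  then have "cis (2 * pi * k $ i) = 1" for i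
    by (auto simp: int_lattice_def elim!: Ints_cases intro: cis_multiple_2pi)
  then show ?thesis
    by (simp add: periodic_def character_def inner_add_right inner_axis cis_mult[symmetric])
qed

lemma trig_poly_const: "trig_poly (\<lambda>x. c)"
  using trig_poly.monomial[OF int_lattice_0, of c] by (simp add: character_def)

lemma trig_poly_mult: "trig_poly f \<Longrightarrow> trig_poly g \<Longrightarrow> trig_poly (\<lambda>x. f x * g x)"
proof (induction rule: trig_poly.induct)
  case (monomial k c)
  from monomial(2) show ?case
  proof (induction rule: trig_poly.induct)
    case (monomial l c')
    have "(\<lambda>x. c * character k x * (c' * character l x)) = (\<lambda>x. (c * c') * character (k + l) x)"
      by (simp add: character_mult[symmetric] algebra_simps)
    then show ?case using trig_poly.monomial int_lattice_add \<open>k \<in> int_lattice\<close> monomial by metis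
  next
    case (add f g)
    then show ?case using trig_poly.add by (simp add: distrib_left)
  qed
next
  case (add f1 f2)
  then show ?case using trig_poly.add by (simp add: distrib_right)
qed

lemma trig_poly_sum: "(\<And>i. i \<in> S \<Longrightarrow> trig_poly (f i)) \<Longrightarrow> trig_poly (\<lambda>x. \<Sum>i\<in>S. f i x)"
  by (induction S rule: infinite_finite_induct) (auto intro: trig_poly_const trig_poly.add)

lemma trig_poly_continuous: "trig_poly f \<Longrightarrow> continuous_on A f"
  by (induction rule: trig_poly.induct) (auto intro!: continuous_intros)

text \<open>A linear form on \<open>\<complex>\<^sup>n\<close>, restricted to the product of circles, is a combination of cosines and sines of the
  coordinates.\<close>

lemma trig_poly_real_polynomial:
  assumes "real_polynomial_function q"
  shows "trig_poly (\<lambda>x::real^'n::finite. complex_of_real (q (torus_map x)))"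
  using assms
proof (induction rule: real_polynomial_function.induct)
  case (linear f)
  interpret bounded_linear f by fact
  have f: "f z = (\<Sum>i\<in>UNIV. Re (z $ i) * f (axis i 1) + Im (z $ i) * f (axis i \<i>))" for z
  proof -
    have "z = (\<Sum>i\<in>UNIV. Re (z $ i) *\<^sub>R axis i 1 + Im (z $ i) *\<^sub>R axis i \<i>)"
      by (simp add: vec_eq_iff axis_def sum.distrib if_distrib complex_eq_iff cong: if_cong)
    then have "f z = f (\<Sum>i\<in>UNIV. Re (z $ i) *\<^sub>R axis i 1 + Im (z $ i) *\<^sub>R axis i \<i>)" by simp
    also have "\<dots> = (\<Sum>i\<in>UNIV. Re (z $ i) * f (axis i 1) + Im (z $ i) * f (axis i \<i>))"
      by (simp add: sum add scaleR)
    finally show ?thesis .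
  qed
  let ?a = "\<lambda>i. complex_of_real (f (axis i 1)) / 2" and ?b = "\<lambda>i. complex_of_real (f (axis i \<i>)) / 2"
  have "complex_of_real (f (torus_map x)) =
    (\<Sum>i\<in>UNIV. (?a i - \<i> * ?b i) * character (axis i 1) x + (?a i + \<i> * ?b i) * character (- axis i 1) x)"
    for x :: "real^'n"
    unfolding f[of "torus_map x"] of_real_sum
    by (intro sum.cong refl) (simp add: torus_map_def character_def inner_axis' complex_eq_iff algebra_simps)
  then show ?case
    by (simp only:) (intro trig_poly_sum trig_poly.intros int_lattice_axis int_lattice_minus)
next
  case (const c)
  show ?case by (rule trig_poly_const)
next
  case (add f g)
  then show ?case using trig_poly.add by simp
next
  case (mult f g)
  then show ?case using trig_poly_mult by simp
qed

text \<open>A function orthogonal to all characters is orthogonal to all trigonometric polynomials. These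
  approximate its conjugate uniformly, by the Stone--Weierstrass theorem on the compact image of the
  torus, so the function is orthogonal to itself.\<close>

lemma fourier_complete:
  fixes g :: "real^'n::finite \<Rightarrow> complex"
  assumes g: "continuous_on UNIV g" and per: "periodic g"
    and zero: "\<And>k. k \<in> int_lattice \<Longrightarrow> integral period_box (\<lambda>x. g x * character k x) = 0"
  shows "g x = 0"
proof -
  have gc: "continuous_on A g" for A using g continuous_on_subset by blast
  have T0: "integral period_box (\<lambda>x. g x * T x) = 0" if "trig_poly T" for T
    using that
  proof (induction rule: trig_poly.induct)
    case (monomial k c)
    have "integral period_box (\<lambda>x. g x * (c * character k x)) = integral period_box (\<lambda>x. c * (g x * character k x))"
      by (intro integral_cong) (simp add: algebra_simps)
    then show ?case using zero[OF monomial] by simp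
  next
    case (add f h)
    have "integral period_box (\<lambda>x. g x * (f x + h x)) =
        integral period_box (\<lambda>x. g x * f x) + integral period_box (\<lambda>x. g x * h x)"
      unfolding distrib_left
      by (intro integral_add integrable_continuous continuous_intros gc trig_poly_continuous add)
    then show ?case using add by simp
  qed
  have "compact (g ` period_box)" by (intro compact_continuous_image gc compact_cbox)
  then obtain B where B: "\<And>x. x \<in> period_box \<Longrightarrow> norm (g x) \<le> B" "0 < B"
    using compact_imp_bounded bounded_pos by (metis imageI)
  have cnj_cont: "continuous_on A (\<lambda>x. cnj (g x))" for A by (intro continuous_intros gc)
  obtain G where G: "continuous_on (range torus_map) G" "\<And>x. G (torus_map x) = cnj (g x)"
    using compact_cover_continuous_factor[OF continuous_torus_map compact_cbox torus_map_period_box cnj_cont]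
      periodic_torus_map[OF per] by metis
  have comp: "compact (range (torus_map :: real^'n \<Rightarrow> _))"
    unfolding torus_map_period_box[symmetric] by (intro compact_continuous_image continuous_torus_map compact_cbox)
  let ?I = "integral period_box (\<lambda>x. g x * cnj (g x))" and ?V = "measure lborel (period_box :: (real^'n) set)"
  have "norm ?I \<le> e * (B * ?V)" if "0 < e" for e
  proof -
    obtain p where p: "polynomial_function p" "\<And>z. z \<in> range torus_map \<Longrightarrow> norm (G z - p z) < e"
      using Stone_Weierstrass_polynomial_function[OF comp G(1) \<open>0 < e\<close>] by blast
    define T where "T = (\<lambda>x. complex_of_real ((Re \<circ> p) (torus_map x)) + \<i> * complex_of_real ((Im \<circ> p) (torus_map x)))"
    have "real_polynomial_function (Re \<circ> p)" "real_polynomial_function (Im \<circ> p)"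
      using p(1) bounded_linear_Re bounded_linear_Im unfolding polynomial_function_def by blast+
    then have T: "trig_poly T"
      unfolding T_def
      by (intro trig_poly.add trig_poly_mult trig_poly_const trig_poly_real_polynomial)
    have Tp: "T x = p (torus_map x)" for x by (simp add: T_def complex_eq_iff)
    have "?I = ?I - integral period_box (\<lambda>x. g x * T x)" using T0[OF T] by simp
    also have "\<dots> = integral period_box (\<lambda>x. g x * cnj (g x) - g x * T x)"
      by (intro integral_diff[symmetric] integrable_continuous continuous_intros gc trig_poly_continuous T)
    also have "norm \<dots> \<le> (B * e) * ?V"
    proof (rule has_integral_bound[OF _ integrable_integral])
      show "(\<lambda>x. g x * cnj (g x) - g x * T x) integrable_on period_box"
        by (intro integrable_continuous continuous_intros gc trig_poly_continuous T)
      fix x :: "real^'n" assume x: "x \<in> period_box"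
      have "norm (cnj (g x) - T x) \<le> e" using p(2)[of "torus_map x"] G(2)[of x] Tp[of x] by (simp add: less_imp_le)
      then show "norm (g x * cnj (g x) - g x * T x) \<le> B * e"
        unfolding right_diff_distrib[symmetric] norm_mult using B(1)[OF x] B(2) by (intro mult_mono) auto
    qed (use B \<open>0 < e\<close> in auto)
    finally show ?thesis by (simp add: algebra_simps)
  qed
  moreover define C where "C = B * ?V"
  ultimately have small: "norm ?I \<le> e * C" if "0 < e" for e using that by simp
  have "norm ?I \<le> 0"
  proof (rule field_le_epsilon)
    fix e :: real assume "0 < e"
    then have "norm ?I \<le> e / (\<bar>C\<bar> + 1) * C" by (intro small) simp
    also have "\<dots> = e * (C / (\<bar>C\<bar> + 1))" by simp
    also have "\<dots> \<le> e * 1" using \<open>0 < e\<close> by (intro mult_left_mono) (auto simp: divide_le_eq)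
    finally show "norm ?I \<le> 0 + e" by simp
  qed
  then have I0: "?I = 0" by simp
  have "((\<lambda>x. g x * cnj (g x)) has_integral 0) period_box"
    unfolding I0[symmetric] by (intro integrable_integral integrable_continuous continuous_intros gc)
  from has_integral_linear[OF this bounded_linear_Re]
  have hi: "((\<lambda>x. (cmod (g x))\<^sup>2) has_integral 0) period_box"
    by (simp add: o_def complex_mult_cnj cmod_power2)
  have on_box: "g y = 0" if "y \<in> period_box" for y
  proof -
    have "(cmod (g y))\<^sup>2 = 0"
      by (rule has_integral_0_cbox_imp_0[OF _ _ hi _ that]) (auto intro!: continuous_intros gc simp: box_ne_empty)
    then show ?thesis by simp
  qed
  obtain v where "v \<in> int_lattice" "x + (2 * pi) *\<^sub>R v \<in> period_box" using period_box_translate by blast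
  then show ?thesis using on_box periodic_int_lattice[OF per] by metis
qed

section \<open>Fourier expansion of eigenfunctions\<close>

text \<open>The eigenvalue of the character \<open>k\<close> for the operator \<open>- (\<Sum>i. w i * \<partial>\<^sub>i\<^sup>2)\<close>.\<close>

definition wave_form :: "('n::finite \<Rightarrow> real) \<Rightarrow> real^'n \<Rightarrow> real" where
  "wave_form w k = (\<Sum>i\<in>UNIV. w i * (k $ i)\<^sup>2)"

lemma finite_wave_form_le:
  assumes w: "\<And>i. 0 < w i"
  shows "finite {k \<in> int_lattice. wave_form w k \<le> C}"
proof -
  let ?A = "\<lambda>i. real_of_int ` {-\<lceil>sqrt (C / w i)\<rceil>..\<lceil>sqrt (C / w i)\<rceil>}"
  have "{k \<in> int_lattice. wave_form w k \<le> C} \<subseteq> (\<lambda>f. \<chi> i. f i) ` (PiE UNIV ?A)"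
  proof
    fix k assume k: "k \<in> {k \<in> int_lattice. wave_form w k \<le> C}"
    have "k $ i \<in> ?A i" for i
    proof -
      obtain n where n: "k $ i = of_int n" using k unfolding int_lattice_def by (auto elim: Ints_cases)
      have "w i * (k $ i)\<^sup>2 \<le> wave_form w k"
        unfolding wave_form_def using w by (intro member_le_sum) (auto simp: less_imp_le)
      then have "(k $ i)\<^sup>2 \<le> C / w i" using k w[of i] by (auto simp: field_simps)
      then have "\<bar>k $ i\<bar> \<le> sqrt (C / w i)" using real_le_rsqrt by fastforce
      then have "\<bar>n\<bar> \<le> \<lceil>sqrt (C / w i)\<rceil>" unfolding n by linarith
      then show ?thesis unfolding n by (intro imageI) (auto simp: abs_le_iff)
    qed
    then show "k \<in> (\<lambda>f. \<chi> i. f i) ` (PiE UNIV ?A)"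
      by (intro image_eqI[of _ _ "\<lambda>i. k $ i"]) auto
  qed
  moreover have "finite ((\<lambda>f. \<chi> i. f i) ` (PiE UNIV ?A) :: (real^'a) set)"
    by (intro finite_imageI finite_PiE) auto
  ultimately show ?thesis by (rule finite_subset)
qed

lemma finite_wave_form_eq:
  assumes w: "\<And>i. 0 < w i"
  shows "finite {k \<in> int_lattice. wave_form w k = \<mu>}"
  by (rule finite_subset[OF _ finite_wave_form_le[where w = w and C = \<mu>, OF w]]) auto

lemma character_directional_derivative:
  "((\<lambda>t. character k (x + t *\<^sub>R axis i 1)) has_vector_derivative \<i> * of_real (k $ i) * character k x) (at 0)"
proof -
  have "character k (x + t *\<^sub>R axis i 1) = character k x * cis (k $ i * t)" for t
    by (simp add: character_def inner_add_right inner_axis cis_mult mult.commute)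
  then have eq: "character k (x + t *\<^sub>R axis i 1) = character k x * exp (\<i> * of_real (k $ i) * of_real t)" for t
    by (simp add: cis_conv_exp mult.assoc)
  have "((\<lambda>z. character k x * exp (\<i> * of_real (k $ i) * z)) has_field_derivative
      \<i> * of_real (k $ i) * character k x) (at (of_real 0))"
    by (auto intro!: derivative_eq_intros)
  from has_vector_derivative_real_field[OF this] show ?thesis unfolding eq .
qed

lemma character_0: "character 0 = (\<lambda>x. 1)"
  by (simp add: character_def fun_eq_iff)

lemma integral_character:
  assumes "k \<in> int_lattice" "k \<noteq> 0"
  shows "integral period_box (character k) = 0"
proof -
  obtain i where i: "k $ i \<noteq> 0" using assms(2) by (auto simp: vec_eq_iff)
  let ?c = "\<i> * complex_of_real (k $ i)"
  have "((\<lambda>t. 1 / ?c * character k (x + t *\<^sub>R axis i 1)) has_vector_derivative character k x) (at 0)" for x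
    using has_vector_derivative_mult_right[OF character_directional_derivative[of k x i], of "1 / ?c"] i by simp
  then show ?thesis
    by (rule integral_partial_derivative_period_box[of "axis i 1", rotated])
      (use periodic_character[OF assms(1)] in \<open>auto simp: periodic_def intro!: continuous_intros simp: axis_in_Basis_iff\<close>)
qed

text \<open>Integrating by parts twice shows that an eigenfunction for \<open>\<mu>\<close> is orthogonal to every character
  whose eigenvalue differs from \<open>\<mu>\<close>. Subtracting the finitely many remaining Fourier components
  leaves a function orthogonal to all characters, which vanishes by completeness.\<close>

lemma fourier_expansion:
  fixes F :: "real^'n::finite \<Rightarrow> real"
  assumes w: "\<And>i. 0 < w i"
    and F: "continuous_on UNIV F" and per: "periodic F"
    and dF: "\<And>x i. ((\<lambda>t. F (x + t *\<^sub>R axis i 1)) has_real_derivative dF i x) (at 0)"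
    and ddF: "\<And>x i. ((\<lambda>t. dF i (x + t *\<^sub>R axis i 1)) has_real_derivative ddF i x) (at 0)"
    and dFc: "\<And>i. continuous_on UNIV (dF i)" and ddFc: "\<And>i. continuous_on UNIV (ddF i)"
    and eig: "\<And>x. - (\<Sum>i\<in>UNIV. w i * ddF i x) = \<mu> * F x"
  obtains c where "\<And>x. F x = (\<Sum>k\<in>{k \<in> int_lattice. wave_form w k = \<mu>}. Re (c k * character k x))"
proof -
  have cF: "continuous_on A F" "continuous_on A (dF i)" "continuous_on A (ddF i)" for A i
    using F dFc ddFc continuous_on_subset by blast+
  have per1: "dF i (x + (2 * pi) *\<^sub>R axis i 1) = dF i x" for i x
  proof -
    have "(\<lambda>t. F ((x + (2 * pi) *\<^sub>R axis i 1) + t *\<^sub>R axis i 1)) = (\<lambda>t. F (x + t *\<^sub>R axis i 1))"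
    proof
      fix t
      show "F ((x + (2 * pi) *\<^sub>R axis i 1) + t *\<^sub>R axis i 1) = F (x + t *\<^sub>R axis i 1)"
        using per[unfolded periodic_def, rule_format, of "x + t *\<^sub>R axis i 1" i] by (simp add: add_ac)
    qed
    then show ?thesis using dF[of "x + (2 * pi) *\<^sub>R axis i 1" i] dF[of x i] DERIV_unique by metis
  qed
  have orth: "integral period_box (\<lambda>x. of_real (F x) * character k x) = 0"
    if k: "k \<in> int_lattice" "wave_form w k \<noteq> \<mu>" for k
  proof -
    let ?D = "\<lambda>i x. (complex_of_real (ddF i x) + of_real ((k $ i)\<^sup>2 * F x)) * character k x"
    have D0: "integral period_box (?D i) = 0" for i
    proof (rule integral_partial_derivative_period_box[of "axis i 1"])
      \<comment> \<open>The derivative of \<open>?G\<close> in direction \<open>i\<close> is \<open>?D i\<close>: the terms with first derivatives cancel.\<close>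
      let ?G = "\<lambda>x. of_real (dF i x) * character k x - of_real (F x) * (\<i> * of_real (k $ i) * character k x)"
      show "((\<lambda>t. ?G (x + t *\<^sub>R axis i 1)) has_vector_derivative ?D i x) (at 0)" for x
        using dF[where x = x and i = i] ddF[where x = x and i = i] character_directional_derivative[where k = k and x = x and i = i]
        by (auto intro!: derivative_eq_intros has_vector_derivative_of_real
            simp: has_real_derivative_iff_has_vector_derivative algebra_simps power2_eq_square)
      show "continuous_on UNIV (?D i)" by (intro continuous_intros cF)
      show "?G (x + (2 * pi) *\<^sub>R axis i 1) = ?G x" for x
        using per periodic_character[OF k(1)] per1 unfolding periodic_def by simp
    qed (simp add: axis_in_Basis_iff)
    have "(of_real (wave_form w k - \<mu>)) * integral period_box (\<lambda>x. of_real (F x) * character k x)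
        = integral period_box (\<lambda>x. of_real (wave_form w k - \<mu>) * (of_real (F x) * character k x))"
      by simp
    also have "\<dots> = integral period_box (\<lambda>x. \<Sum>i\<in>UNIV. of_real (w i) * ?D i x)"
    proof (intro integral_cong)
      fix x
      have "(\<Sum>i\<in>UNIV. of_real (w i) * ?D i x) =
          of_real ((\<Sum>i\<in>UNIV. w i * ddF i x) + wave_form w k * F x) * character k x"
        unfolding wave_form_def
        by (simp add: sum_distrib_right sum_distrib_left sum.distrib[symmetric] algebra_simps)
      also have "(\<Sum>i\<in>UNIV. w i * ddF i x) = - \<mu> * F x" using eig[of x] by simp
      finally show "of_real (wave_form w k - \<mu>) * (of_real (F x) * character k x) = (\<Sum>i\<in>UNIV. of_real (w i) * ?D i x)"
        by (simp add: algebra_simps)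
    qed
    also have "\<dots> = (\<Sum>i\<in>UNIV. integral period_box (\<lambda>x. of_real (w i) * ?D i x))"
      by (intro integral_sum integrable_continuous continuous_intros cF) auto
    also have "\<dots> = 0" using D0 by simp
    finally show ?thesis using k(2) by simp
  qed
  let ?K = "{k \<in> int_lattice. wave_form w k = \<mu>}"
  let ?V = "measure lborel (period_box :: (real^'n) set)"
  have fin: "finite ?K" by (rule finite_wave_form_eq[OF w])
  have V: "?V > 0" by (simp add: content_pos_lt_eq)
  define c where "c k = integral period_box (\<lambda>x. of_real (F x) * character (- k) x) / of_real ?V" for k
  define g where "g x = of_real (F x) - (\<Sum>k\<in>?K. c k * character k x)" for x
  have "g x = 0" for x
  proof (rule fourier_complete)
    show "continuous_on UNIV g" unfolding g_def by (intro continuous_intros cF)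
    have "character k (x + (2 * pi) *\<^sub>R axis i 1) = character k x" if "k \<in> int_lattice" for k x i
      using periodic_character[OF that] unfolding periodic_def by blast
    then show "periodic g"
      using per unfolding g_def periodic_def
      by (intro allI arg_cong2[where f = minus] sum.cong refl) auto
    fix l :: "real^'n" assume l: "l \<in> int_lattice"
    have "integral period_box (\<lambda>x. g x * character l x) =
       integral period_box (\<lambda>x. of_real (F x) * character l x - (\<Sum>k\<in>?K. c k * character (k + l) x))"
      by (intro integral_cong) (simp add: g_def left_diff_distrib sum_distrib_right character_mult mult.assoc)
    also have "\<dots> = integral period_box (\<lambda>x. of_real (F x) * character l x)
        - integral period_box (\<lambda>x. (\<Sum>k\<in>?K. c k * character (k + l) x))"
      by (intro integral_diff integrable_continuous continuous_intros cF)
    also have "integral period_box (\<lambda>x. (\<Sum>k\<in>?K. c k * character (k + l) x)) =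
        (\<Sum>k\<in>?K. integral period_box (\<lambda>x. c k * character (k + l) x))"
      by (intro integral_sum integrable_continuous continuous_intros fin)
    also have "\<dots> = (\<Sum>k\<in>?K. if k = - l then c k * of_real ?V else 0)"
    proof (intro sum.cong refl)
      fix k assume "k \<in> ?K"
      have "integral (period_box :: (real^'n) set) (character 0) = of_real ?V"
        unfolding character_0 integral_const of_real_def ..
      then have "integral period_box (character (k + l)) = (if k = - l then of_real ?V else 0)"
        using integral_character[of "k + l"] \<open>k \<in> ?K\<close> int_lattice_add l
        by (auto simp: eq_neg_iff_add_eq_0)
      then show "integral period_box (\<lambda>x. c k * character (k + l) x) = (if k = - l then c k * of_real ?V else 0)"
        by simp
    qed
    also have "\<dots> = (if - l \<in> ?K then c (- l) * of_real ?V else 0)" using fin by (simp add: sum.delta)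
    also have "\<dots> = integral period_box (\<lambda>x. of_real (F x) * character l x)"
    proof (cases "wave_form w l = \<mu>")
      case True
      then have "- l \<in> ?K" using l int_lattice_minus by (simp add: wave_form_def)
      then show ?thesis using V by (simp add: c_def)
    next
      case False
      then show ?thesis using orth[OF l] by (simp add: wave_form_def)
    qed
    finally show "integral period_box (\<lambda>x. g x * character l x) = 0" by simp
  qed
  then have "complex_of_real (F x) = (\<Sum>k\<in>?K. c k * character k x)" for x unfolding g_def by simp
  then have "F x = (\<Sum>k\<in>?K. Re (c k * character k x))" for x by (metis Re_complex_of_real Re_sum)
  then show ?thesis using that by blast
qed

section \<open>Smooth maps and their Jacobians\<close>

text \<open>Also without differentiability, since the derivative is chosen from a set that depends only on the
  germ.\<close>

lemma frechet_derivative_cong_open: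
  assumes "open U" "x \<in> U" and eq: "\<And>y. y \<in> U \<Longrightarrow> f y = g y"
  shows "frechet_derivative f (at x) = frechet_derivative g (at x)"
proof -
  have "(f has_derivative D) (at x) \<longleftrightarrow> (g has_derivative D) (at x)" for D
    using has_derivative_transform_within_open[OF _ assms(1,2)] eq by metis
  then show ?thesis unfolding frechet_derivative_def by simp
qed

lemma Ck_on_cong:
  assumes "open U" and "\<And>x. x \<in> U \<Longrightarrow> f x = g x" and "Ck_on k U f"
  shows "Ck_on k U g"
  using assms(2,3)
proof (induction k arbitrary: f g)
  case 0
  then show ?case using continuous_on_cong[of U U f g] by simp
next
  case (Suc k)
  have "g differentiable (at x within U)" if x: "x \<in> U" for x
  proof -
    obtain D where "(f has_derivative D) (at x within U)"
      using Suc.prems(2) x unfolding Ck_on.simps differentiable_on_def differentiable_def by blast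
    then have "(g has_derivative D) (at x within U)"
      by (rule has_derivative_transform[OF x, rotated]) (simp add: Suc.prems(1))
    then show ?thesis unfolding differentiable_def by blast
  qed
  moreover have "partial_deriv i f x = partial_deriv i g x" if "x \<in> U" for i x
    unfolding partial_deriv_def
    by (simp add: frechet_derivative_cong_open[OF assms(1) that Suc.prems(1)])
  then have "Ck_on k U (partial_deriv i g)" for i
    using Suc.prems(2) by (intro Suc.IH[of "partial_deriv i f" "partial_deriv i g"]) auto
  ultimately show ?case by (simp add: differentiable_on_def)
qed

lemma Ck_on_subset: "Ck_on k U f \<Longrightarrow> V \<subseteq> U \<Longrightarrow> Ck_on k V f"
  by (induction k arbitrary: f) (auto intro: continuous_on_subset differentiable_on_subset)

lemma smooth_on_subset: "smooth_on U f \<Longrightarrow> V \<subseteq> U \<Longrightarrow> smooth_on V f"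
  unfolding smooth_on_def using Ck_on_subset by blast

lemma smooth_on_cong:
  "open U \<Longrightarrow> (\<And>x. x \<in> U \<Longrightarrow> f x = g x) \<Longrightarrow> smooth_on U f \<Longrightarrow> smooth_on U g"
  unfolding smooth_on_def using Ck_on_cong by blast

lemma Ck_on_locally:
  assumes "\<And>x. \<exists>U. open U \<and> x \<in> U \<and> Ck_on k U f"
  shows "Ck_on k UNIV f"
  using assms
proof (induction k arbitrary: f)
  case 0
  have "isCont f x" for x
    using 0[of x] continuous_on_eq_continuous_at by (auto simp del: split_paired_Ex)
  then show ?case by (simp add: continuous_at_imp_continuous_on)
next
  case (Suc k)
  have "f differentiable (at x)" for x
  proof -
    obtain U where "open U" "x \<in> U" "f differentiable_on U" using Suc.prems[of x] by auto
    then show ?thesis using differentiable_on_eq_differentiable_at by blast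
  qed
  then have "f differentiable_on UNIV" by (simp add: differentiable_on_def)
  moreover have "Ck_on k UNIV (partial_deriv i f)" for i
  proof (rule Suc.IH)
    fix x
    show "\<exists>U. open U \<and> x \<in> U \<and> Ck_on k U (partial_deriv i f)" using Suc.prems[of x] by auto
  qed
  ultimately show ?case by simp
qed

lemma smooth_on_const: "smooth_on U (\<lambda>x::real^'n::finite. c)"
proof -
  have "Ck_on k U (\<lambda>x::real^'n. c)" for k
  proof (induction k arbitrary: c)
    case (Suc k)
    have "partial_deriv i (\<lambda>x::real^'n. c) = (\<lambda>x. 0)" for i
      by (simp add: partial_deriv_def fun_eq_iff frechet_derivative_const)
    then show ?case using Suc by simp
  qed simp
  then show ?thesis by (simp add: smooth_on_def)
qed

lemma smooth_on_continuous: "smooth_on U f \<Longrightarrow> continuous_on U f"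
  unfolding smooth_on_def by (metis Ck_on.simps(1))

lemma smooth_on_differentiable: "smooth_on U f \<Longrightarrow> f differentiable_on U"
  unfolding smooth_on_def by (metis Ck_on.simps(2))

lemma smooth_on_partial_deriv: "smooth_on U f \<Longrightarrow> smooth_on U (partial_deriv i f)"
  unfolding smooth_on_def by (metis Ck_on.simps(2))

lemma partial_deriv_directional:
  fixes f :: "real^'n::finite \<Rightarrow> real"
  assumes "f differentiable (at x)"
  shows "((\<lambda>t. f (x + t *\<^sub>R axis i 1)) has_real_derivative partial_deriv i f x) (at 0)"
proof -
  have "(f has_derivative frechet_derivative f (at x)) (at (x + 0 *\<^sub>R axis i 1))"
    using frechet_derivative_works[THEN iffD1, OF assms] by simp
  then have "((\<lambda>t. f (x + t *\<^sub>R axis i 1)) has_derivative (\<lambda>t. frechet_derivative f (at x) (t *\<^sub>R axis i 1))) (at 0)"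
    by (rule has_derivative_compose[rotated]) (auto intro!: derivative_eq_intros)
  moreover have "frechet_derivative f (at x) (t *\<^sub>R axis i 1) = t * partial_deriv i f x" for t
    using linear_frechet_derivative[OF assms] by (simp add: linear_cmul partial_deriv_def)
  ultimately show ?thesis 
    unfolding has_field_derivative_def mult.commute[of "partial_deriv i f x"] by simp
qed

lemma partial_deriv_eqI:
  assumes "(f has_derivative f') (at x)"
  shows "partial_deriv i f x = f' (axis i 1)"
  unfolding partial_deriv_def using frechet_derivative_at[OF assms] by simp

text \<open>The two-parameter form is closed under differentiation, so smoothness follows by induction.\<close>

lemma smooth_on_trig:
  fixes a :: real
  shows "smooth_on U (\<lambda>x::real^'n::finite. \<alpha> * cos (a * x $ i) + \<beta> * sin (a * x $ i))"
    and "partial_deriv j (\<lambda>x::real^'n::finite. \<alpha> * cos (a * x $ i) + \<beta> * sin (a * x $ i)) =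
      (\<lambda>x. (if j = i then a * \<beta> else 0) * cos (a * x $ i) + (if j = i then - a * \<alpha> else 0) * sin (a * x $ i))"
proof -
  let ?f = "\<lambda>\<alpha> \<beta> (x::real^'n). \<alpha> * cos (a * x $ i) + \<beta> * sin (a * x $ i)"
  have der: "(?f \<alpha> \<beta> has_derivative
      (\<lambda>h. a * h $ i * (\<beta> * cos (a * x $ i) - \<alpha> * sin (a * x $ i)))) (at x within A)" for \<alpha> \<beta> x A
    by (auto intro!: derivative_eq_intros bounded_linear.has_derivative[OF bounded_linear_vec_nth]
        simp: algebra_simps)
  have pd: "partial_deriv j (?f \<alpha> \<beta>) = ?f (if j = i then a * \<beta> else 0) (if j = i then - a * \<alpha> else 0)" for \<alpha> \<beta> j
    by (rule ext, subst partial_deriv_eqI[OF der]) (auto simp: axis_def algebra_simps)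
  show "partial_deriv j (?f \<alpha> \<beta>) = ?f (if j = i then a * \<beta> else 0) (if j = i then - a * \<alpha> else 0)"
    by (rule pd)
  have "Ck_on k U (?f \<alpha> \<beta>)" for k
  proof (induction k arbitrary: \<alpha> \<beta>)
    case 0
    show ?case by (auto intro!: continuous_intros)
  next
    case (Suc k)
    have "?f \<alpha> \<beta> differentiable_on U" using der unfolding differentiable_on_def differentiable_def by blast
    then show ?case unfolding Ck_on.simps pd using Suc by blast
  qed
  then show "smooth_on U (?f \<alpha> \<beta>)" by (simp add: smooth_on_def)
qed

definition diag_mat :: "real^'n::finite \<Rightarrow> real^'n^'n" where
  "diag_mat s = (\<chi> i j. if i = j then s $ i else 0)"

lemma diag_mat_vector: "diag_mat s *v x = s * x"
  by (simp add: diag_mat_def matrix_vector_mult_def vec_eq_iff if_distrib[of "\<lambda>c. c * _"] cong: if_cong)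

lemma bounded_linear_mult_vec: "bounded_linear (\<lambda>x::real^'n::finite. s * x)"
  unfolding diag_mat_vector[symmetric] by (rule matrix_vector_mul_bounded_linear)

lemma det_diag_mat: "det (diag_mat s) = (\<Prod>i\<in>UNIV. s $ i)"
  by (subst det_diagonal) (auto simp: diag_mat_def)

lemma jacobian_matrix_affine_comp:
  fixes f g :: "real^'n::finite \<Rightarrow> real^'n"
  assumes "open W" "u \<in> W" and eq: "\<And>x. x \<in> W \<Longrightarrow> g x = v + s * f x" and f: "f differentiable (at u)"
  shows "jacobian_matrix g u = diag_mat s ** jacobian_matrix f u"
proof -
  let ?D = "frechet_derivative f (at u)"
  have fD: "(f has_derivative ?D) (at u)" using f frechet_derivative_works by blast
  have "((\<lambda>x. s * f x) has_derivative (\<lambda>h. s * ?D h)) (at u)"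
    by (rule bounded_linear.has_derivative[OF bounded_linear_mult_vec fD])
  from has_derivative_add[OF has_derivative_const this]
  have "((\<lambda>x. v + s * f x) has_derivative (\<lambda>h. s * ?D h)) (at u)" by simp
  then have "(\<lambda>h. s * ?D h) = frechet_derivative (\<lambda>x. v + s * f x) (at u)"
    by (rule frechet_derivative_at)
  also have "\<dots> = frechet_derivative g (at u)"
    by (rule frechet_derivative_cong_open[OF assms(1,2)]) (simp add: eq)
  finally have "frechet_derivative g (at u) = (\<lambda>h. s * ?D h)" by simp
  then show ?thesis
    unfolding jacobian_matrix_def
    by (simp add: matrix_def diag_mat_def matrix_matrix_mult_def vec_eq_iff if_distrib[of "\<lambda>c. c * _"] cong: if_cong)
qed

lemma smooth_on_affine: "smooth_on U (\<lambda>x::real^'n::finite. v + s * x)"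
  and jacobian_matrix_affine: "jacobian_matrix (\<lambda>x::real^'n::finite. v + s * x) u = diag_mat s"
proof -
  have der: "((\<lambda>x. v + s * x) has_derivative (\<lambda>h. s * h)) (at x within A)" for x A
    using has_derivative_add[OF has_derivative_const
        bounded_linear.has_derivative[OF bounded_linear_mult_vec has_derivative_ident]] by simp
  have pd: "partial_deriv i (\<lambda>x. v + s * x) = (\<lambda>x. s * axis i 1)" for i
    using partial_deriv_eqI[OF der] by (simp add: fun_eq_iff)
  have "Ck_on k U (\<lambda>x. v + s * x)" for k
  proof (cases k)
    case 0
    then show ?thesis using has_derivative_continuous_on[OF der] by simp
  next
    case (Suc k')
    have "(\<lambda>x. v + s * x) differentiable_on U"
      using der unfolding differentiable_on_def differentiable_def by blast
    then show ?thesis unfolding Suc Ck_on.simps pd using smooth_on_const unfolding smooth_on_def by blast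
  qed
  then show "smooth_on U (\<lambda>x::real^'n::finite. v + s * x)" by (simp add: smooth_on_def)
  show "jacobian_matrix (\<lambda>x::real^'n::finite. v + s * x) u = diag_mat s"
    unfolding jacobian_matrix_def frechet_derivative_at[OF der, symmetric]
    by (simp add: matrix_def diag_mat_def vec_eq_iff axis_def)
qed

lemma continuous_on_jacobian_matrix:
  assumes "smooth_on U f"
  shows "continuous_on U (jacobian_matrix f)"
proof -
  have "continuous_on U (\<lambda>x. \<chi> i j. partial_deriv j f x $ i)"
    using smooth_on_continuous[OF smooth_on_partial_deriv[OF assms]]
    by (intro continuous_on_vec_lambda continuous_on_component) auto
  moreover have "jacobian_matrix f = (\<lambda>x. \<chi> i j. partial_deriv j f x $ i)"
    by (simp add: fun_eq_iff jacobian_matrix_def matrix_def partial_deriv_def)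
  ultimately show ?thesis by simp
qed

text \<open>Otherwise some closed ball would be a countable union of relatively closed sets without interior,
  against Baire's theorem.\<close>

lemma dense_interiors_of_countable_closed_cover:
  fixes U :: "'a::{real_normed_vector,heine_borel} set"
  assumes U: "open U" and I: "countable I"
    and closed: "\<And>i. i \<in> I \<Longrightarrow> closedin (top_of_set U) (F i)" and cover: "U \<subseteq> (\<Union>i\<in>I. F i)"
  shows "U \<subseteq> closure (\<Union>i\<in>I. interior (F i))"
proof
  fix u assume u: "u \<in> U"
  show "u \<in> closure (\<Union>i\<in>I. interior (F i))" (is "u \<in> closure ?D")
  proof (rule ccontr)
    assume "u \<notin> closure ?D"
    then have "open (U - closure ?D)" "u \<in> U - closure ?D" using u U by auto
    then obtain r where r: "0 < r" "cball u r \<subseteq> U - closure ?D" using open_contains_cball by metis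
    let ?S = "cball u r"
    have SU: "?S \<subseteq> U" using r by blast
    have "\<exists>i\<in>I. \<not> ?S \<subseteq> closure (?S - F i)"
    proof (rule ccontr)
      assume dense: "\<not> ?thesis"
      have "?S \<subseteq> closure (\<Inter>((\<lambda>i. ?S - F i) ` I))"
      proof (rule Baire)
        fix T assume "T \<in> (\<lambda>i. ?S - F i) ` I"
        then obtain i where i: "i \<in> I" "T = ?S - F i" by blast
        obtain C where "closed C" "F i = U \<inter> C" using closed[OF i(1)] closedin_closed by metis
        then have "T = ?S \<inter> (- C)" "open (- C)" using i SU by auto
        then show "openin (top_of_set ?S) T \<and> ?S \<subseteq> closure T"
          using dense i openin_open by metis
      qed (use I in auto)
      moreover have "I \<noteq> {}" using cover u by auto
      then have "\<Inter>((\<lambda>i. ?S - F i) ` I) = {}" using cover SU by blast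
      ultimately show False using r(1) by simp
    qed
    then obtain i y where i: "i \<in> I" "y \<in> ?S" "y \<notin> closure (?S - F i)" by blast
    have op: "open (- closure (?S - F i))" by (rule open_Compl[OF closed_closure])
    have "y \<in> - closure (?S - F i) \<inter> closure (ball u r)" using i r(1) by simp
    then have "- closure (?S - F i) \<inter> ball u r \<noteq> {}"
      using open_Int_closure_eq_empty[OF op, of "ball u r"] by blast
    then obtain z where z: "z \<in> ball u r \<inter> - closure (?S - F i)" by blast
    have "ball u r \<inter> - closure (?S - F i) \<subseteq> F i"
      using closure_subset[of "?S - F i"] ball_subset_cball[of u r] by blast
    then have "z \<in> interior (F i)" 
      using z by (intro interiorI[OF open_Int[OF open_ball op]])
    then have "z \<in> ?D" by (rule UN_I[OF i(1)])
    then have "z \<in> closure ?D" by (rule closure_subset[THEN subsetD])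
    moreover have "z \<in> ?S" using z by simp
    ultimately show False using r(2) by blast
  qed
qed

lemma countable_int_lattice: "countable (int_lattice :: (real^'n::finite) set)"
proof -
  have "v \<in> range (\<lambda>f::'n \<Rightarrow> int. \<chi> i. of_int (f i))" if "v \<in> int_lattice" for v :: "real^'n"
  proof -
    have "\<exists>n::int. v $ i = of_int n" for i using that unfolding int_lattice_def by (auto elim: Ints_cases)
    then obtain f :: "'n \<Rightarrow> int" where "\<And>i. v $ i = of_int (f i)" by metis
    then show ?thesis by (auto simp: vec_eq_iff intro!: image_eqI[of _ _ f])
  qed
  then show ?thesis by (rule countable_subset[OF subsetI]) auto
qed

text \<open>As \<open>f\<close> and \<open>g\<close> agree in the quotient, the sets on which \<open>g\<close> is a given group element
  composed with \<open>f\<close> form a countable closed cover. On the interiors of these sets the Jacobians differ by the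
  linear part of that element, and the interiors are dense.\<close>

lemma jacobian_closed_relation:
  fixes f g :: "real^'n::finite \<Rightarrow> real^'n"
  assumes U: "open U" and f: "smooth_on U f" and g: "smooth_on U g" and S: "finite S"
    and orbit: "\<And>x. x \<in> U \<Longrightarrow> \<exists>s\<in>S. \<exists>v\<in>int_lattice. g x = (2 * pi) *\<^sub>R v + s * f x"
    and Z: "closed Z" and rel: "\<And>A s. s \<in> S \<Longrightarrow> (A, diag_mat s ** A) \<in> Z"
    and u: "u \<in> U"
  shows "(jacobian_matrix f u, jacobian_matrix g u) \<in> Z"
proof -
  let ?J = "\<lambda>x. (jacobian_matrix f x, jacobian_matrix g x)"
  let ?F = "\<lambda>(s, v). {x \<in> U. g x = (2 * pi) *\<^sub>R v + s * f x}"
  have cont: "continuous_on U f" "continuous_on U g" using f g smooth_on_continuous by auto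
  have clos: "closedin (top_of_set U) (?F p)" if "p \<in> S \<times> int_lattice" for p
  proof -
    have "continuous_on U (\<lambda>x. g x - (2 * pi) *\<^sub>R snd p - diag_mat (fst p) *v f x)"
      by (intro continuous_intros cont
          continuous_on_compose2[OF linear_continuous_on[OF matrix_vector_mul_bounded_linear]]) auto
    from continuous_closedin_preimage_constant[OF this, of 0]
    show ?thesis by (simp add: split_def diag_mat_vector algebra_simps)
  qed
  have dense: "U \<subseteq> closure (\<Union>p\<in>S \<times> int_lattice. interior (?F p))"
  proof (rule dense_interiors_of_countable_closed_cover[OF U _ clos])
    show "countable (S \<times> (int_lattice :: (real^'n) set))"
      by (intro countable_SIGMA[OF countable_finite[OF S]] countable_int_lattice)
    show "U \<subseteq> (\<Union>p\<in>S \<times> int_lattice. ?F p)"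
    proof
      fix x assume x: "x \<in> U"
      then obtain s v where "s \<in> S" "v \<in> int_lattice" "g x = (2 * pi) *\<^sub>R v + s * f x"
        using orbit by blast
      then show "x \<in> (\<Union>p\<in>S \<times> int_lattice. ?F p)" using x by (intro UN_I[of "(s, v)"]) auto
    qed
  qed
  have "continuous_on U ?J" by (intro continuous_on_Pair continuous_on_jacobian_matrix f g)
  then have "closedin (top_of_set U) (U \<inter> ?J -` Z)" using Z by (rule continuous_closedin_preimage)
  then obtain C where C: "closed C" "U \<inter> ?J -` Z = U \<inter> C" unfolding closedin_closed by blast
  have "(\<Union>p\<in>S \<times> int_lattice. interior (?F p)) \<subseteq> C"
  proof
    fix x assume "x \<in> (\<Union>p\<in>S \<times> int_lattice. interior (?F p))"
    then obtain s v where sv: "s \<in> S" "x \<in> interior {x \<in> U. g x = (2 * pi) *\<^sub>R v + s * f x}" by auto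
    then have xU: "x \<in> U" using interior_subset by blast
    have "f differentiable (at x)"
      using smooth_on_differentiable[OF f] differentiable_on_eq_differentiable_at[OF U] xU by blast
    then have "jacobian_matrix g x = diag_mat s ** jacobian_matrix f x"
      using interior_subset by (intro jacobian_matrix_affine_comp[OF open_interior sv(2), of g "(2 * pi) *\<^sub>R v"]) auto
    then have "x \<in> U \<inter> ?J -` Z" using rel[OF sv(1)] xU by simp
    then show "x \<in> C" using C by blast
  qed
  then have "U \<subseteq> C" using dense C(1) closure_minimal by blast
  then have "u \<in> U \<inter> ?J -` Z" unfolding C(2) using u by blast
  then show ?thesis by simp
qed

section \<open>Spaces coded by real numbers\<close>

text \<open>The points of the orbifolds are real numbers, so the compact subsets of \<open>\<complex>\<^sup>n\<close> in which the quotients embed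
  naturally have to be transported along an injection; it only has to exist, by cardinality.\<close>

lemma ex_inj_real: "\<exists>f :: complex^'n::finite \<Rightarrow> real. inj f"
proof -
  have "(UNIV :: real set) \<lesssim> (UNIV :: nat set set)"
    by (rule eqpoll_imp_lepoll[OF eqpoll_sym[OF nat_sets_eqpoll_reals]])
  then obtain h :: "real \<Rightarrow> nat set" where h: "inj h" unfolding lepoll_def by auto
  have "(UNIV :: nat set set) \<lesssim> (UNIV :: real set)"
    by (rule eqpoll_imp_lepoll[OF nat_sets_eqpoll_reals])
  then obtain h' :: "nat set \<Rightarrow> real" where h': "inj h'" unfolding lepoll_def by auto
  define code where "code z = to_nat ` {(i, b, k). k \<in> h (if b then Re (z $ i) else Im (z $ i))}" for z :: "complex^'n"
  have "inj code"
  proof (rule injI)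
    fix y z assume "code y = code z"
    then have "{(i, b, k). k \<in> h (if b then Re (y $ i) else Im (y $ i))} =
        {(i, b, k). k \<in> h (if b then Re (z $ i) else Im (z $ i))}"
      unfolding code_def by (simp only: inj_image_eq_iff[OF inj_to_nat])
    then have "k \<in> h (if b then Re (y $ i) else Im (y $ i)) \<longleftrightarrow> k \<in> h (if b then Re (z $ i) else Im (z $ i))" for i b k
      unfolding set_eq_iff by auto
    then have "h (if b then Re (y $ i) else Im (y $ i)) = h (if b then Re (z $ i) else Im (z $ i))" for i b
      by blast
    then have eq: "(if b then Re (y $ i) else Im (y $ i)) = (if b then Re (z $ i) else Im (z $ i))" for i b
      by (rule injD[OF h])
    show "y = z"
      using eq[of True] eq[of False] by (simp add: vec_eq_iff complex_eq_iff)
  qed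
  then have "inj (h' \<circ> code)" by (rule inj_compose[OF h'])
  then show ?thesis by blast
qed

definition real_code :: "complex^'n::finite \<Rightarrow> real" where
  "real_code = (SOME f. inj f)"

lemma inj_real_code: "inj real_code"
  unfolding real_code_def using ex_inj_real by (rule someI_ex)

lemma real_code_eq_iff: "real_code x = real_code y \<longleftrightarrow> x = y"
  using inj_eq[OF inj_real_code] .

text \<open>The topology that makes \<open>real_code\<close> a homeomorphism from \<open>T\<close> onto its image; it is unrelated to the usual
  topology of the reals.\<close>

definition code_topology :: "(complex^'n::finite) set \<Rightarrow> real topology" where
  "code_topology T =
     pullback_topology (real_code ` T) (inv_into UNIV (real_code :: complex^'n \<Rightarrow> real)) euclidean"

lemma inv_real_code: "inv_into UNIV real_code (real_code x) = x"
  by (rule inv_into_f_f[OF inj_real_code]) simp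

lemma homeomorphic_map_real_code:
  fixes T :: "(complex^'n::finite) set"
  shows "homeomorphic_map (top_of_set T) (code_topology T) real_code"
  unfolding homeomorphic_map_maps
proof
  let ?inv = "inv_into UNIV (real_code :: complex^'n \<Rightarrow> real)"
  have "continuous_map (top_of_set T) (code_topology T) real_code"
    unfolding code_topology_def
    by (rule continuous_map_pullback')
      (auto simp: o_def inv_real_code intro: continuous_map_from_subtopology[of _ _ "\<lambda>x. x"])
  moreover have "continuous_map (code_topology T) euclidean (id \<circ> ?inv)"
    unfolding code_topology_def by (rule continuous_map_pullback) simp
  then have "continuous_map (code_topology T) (top_of_set T) (?inv)"
    by (auto simp: continuous_map_in_subtopology code_topology_def topspace_pullback_topology inv_real_code)
  ultimately show "homeomorphic_maps (top_of_set T) (code_topology T) real_code (?inv)"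
    by (auto simp: homeomorphic_maps_def inv_real_code code_topology_def topspace_pullback_topology)
qed

lemma topspace_code_topology: "topspace (code_topology T) = real_code ` T"
  using homeomorphic_imp_surjective_map[OF homeomorphic_map_real_code[of T]] by simp

lemma openin_code_topology: "openin (top_of_set T) U \<Longrightarrow> openin (code_topology T) (real_code ` U)"
  using homeomorphic_map_openness_eq[OF homeomorphic_map_real_code] by blast


section \<open>Flat orbifolds\<close>

text \<open>The orbits of the group are discrete; this is the statement for one coordinate.\<close>

lemma discrete_progression: "\<exists>\<delta>>0. \<forall>n::int. \<bar>b + 2 * pi * n\<bar> < \<delta> \<longrightarrow> b + 2 * pi * n = 0"
proof -
  define f where "f = frac (b / (2 * pi))"
  define m where "m = \<lfloor>b / (2 * pi)\<rfloor>"
  have b: "b + 2 * pi * n = 2 * pi * (of_int (m + n) + f)" for n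
    by (simp add: f_def m_def frac_def field_simps)
  have f: "0 \<le> f" "f < 1" by (auto simp: f_def frac_lt_1)
  let ?\<delta> = "if f = 0 then 2 * pi else 2 * pi * min f (1 - f)"
  have "b + 2 * pi * n = 0" if n: "\<bar>b + 2 * pi * n\<bar> < ?\<delta>" for n :: int
  proof -
    have "2 * pi * \<bar>of_int (m + n) + f\<bar> < 2 * pi * (if f = 0 then 1 else min f (1 - f))"
      using n unfolding b by (auto simp: abs_mult split: if_splits)
    then have lt: "\<bar>of_int (m + n) + f\<bar> < (if f = 0 then 1 else min f (1 - f))" by simp
    show ?thesis
    proof (cases "f = 0")
      case True
      then have "\<bar>real_of_int (m + n)\<bar> < 1" using lt by simp
      then have "m + n = 0" by linarith
      then show ?thesis unfolding b using True by simp
    next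
      case False
      then have "\<bar>of_int (m + n) + f\<bar> < f" "\<bar>of_int (m + n) + f\<bar> < 1 - f" using lt by auto
      then have "-1 < real_of_int (m + n)" "real_of_int (m + n) < 0" using f by linarith+
      then have "-1 < m + n" "m + n < 0" by linarith+
      then show ?thesis by simp
    qed
  qed
  moreover have "0 < ?\<delta>" using f by auto
  ultimately show ?thesis by blast
qed

lemma norm_sign_mult:
  fixes s x :: "real^'n::finite"
  assumes "\<And>i. s $ i = 1 \<or> s $ i = - 1"
  shows "norm (s * x) = norm x"
proof -
  have "(s $ i * x $ i) * (s $ i * x $ i) = x $ i * x $ i" for i using assms[of i] by auto
  then have "(s * x) \<bullet> (s * x) = x \<bullet> x"
    unfolding inner_vec_def by (simp only: vector_mult_component inner_real_def)
  then show ?thesis by (simp add: norm_eq_sqrt_inner)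
qed

text \<open>The quotient of \<open>\<real>\<^sup>n\<close> by the group of all maps \<open>x \<mapsto> 2\<pi>v + s * x\<close> with \<open>v\<close> in the integer lattice and
  \<open>s\<close> in a group \<open>S\<close> of sign vectors, multiplied componentwise. The map \<open>E\<close> embeds the quotient
  in \<open>\<complex>\<^sup>n\<close>, so the Hausdorff property, second countability and compactness come for free. The
  condition on the product of the signs makes the group preserve the orientation.\<close>

locale flat_orbifold =
  fixes S :: "(real^'n::finite) set" and E :: "real^'n \<Rightarrow> complex^'n"
  assumes S_sign: "s \<in> S \<Longrightarrow> s $ i = 1 \<or> s $ i = - 1"
    and S_one: "1 \<in> S"
    and S_mult: "s \<in> S \<Longrightarrow> t \<in> S \<Longrightarrow> s * t \<in> S"
    and S_det: "s \<in> S \<Longrightarrow> (\<Prod>i\<in>UNIV. s $ i) = 1"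
    and E_cont: "continuous_on A E"
    and E_eq: "E x = E y \<longleftrightarrow> (\<exists>s\<in>S. \<exists>v\<in>int_lattice. y = (2 * pi) *\<^sub>R v + s * x)"
begin

lemma S_square: "s \<in> S \<Longrightarrow> s * s = 1"
proof -
  assume "s \<in> S"
  then have "s $ i * s $ i = 1" for i using S_sign[of s i] by auto
  then show ?thesis by (simp add: vec_eq_iff)
qed

lemma S_cancel: "s \<in> S \<Longrightarrow> s * (s * x) = x"
  by (simp add: mult.assoc[symmetric] S_square)

lemma norm_S: "s \<in> S \<Longrightarrow> norm (s * x) = norm x"
  using norm_sign_mult S_sign by blast

lemma finite_S: "finite S"
proof -
  have "S \<subseteq> (\<lambda>f. \<chi> i. f i) ` (PiE UNIV (\<lambda>_. {1, -1}))"
  proof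
    fix s assume "s \<in> S"
    then show "s \<in> (\<lambda>f. \<chi> i. f i) ` (PiE UNIV (\<lambda>_. {1, -1}))"
      using S_sign[of s] by (intro image_eqI[of _ _ "\<lambda>i. s $ i"]) auto
  qed
  then show ?thesis by (rule finite_subset) (intro finite_imageI finite_PiE, auto)
qed

lemma E_lattice: "v \<in> int_lattice \<Longrightarrow> E (x + (2 * pi) *\<^sub>R v) = E x"
proof -
  assume v: "v \<in> int_lattice"
  then have "E x = E (x + (2 * pi) *\<^sub>R v)"
    unfolding E_eq by (intro bexI[OF _ S_one] bexI[OF _ v]) (simp add: add.commute)
  then show ?thesis by simp
qed

lemma E_period_box: "E ` period_box = range E"
proof
  show "range E \<subseteq> E ` period_box"
  proof
    fix z assume "z \<in> range E"
    then obtain x where x: "z = E x" by blast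
    obtain v where "v \<in> int_lattice" "x + (2 * pi) *\<^sub>R v \<in> period_box"
      using period_box_translate by blast
    then show "z \<in> E ` period_box" using x E_lattice[of v x] by (intro image_eqI[of _ _ "x + (2 * pi) *\<^sub>R v"]) auto
  qed
qed auto

lemma compact_range_E: "compact (range E)"
  unfolding E_period_box[symmetric] by (intro compact_continuous_image E_cont compact_cbox)

text \<open>The saturation of \<open>U\<close> is open as a union of images under the group, and the complement of \<open>E ` U\<close> is the
  image of the compact part of the period box outside the saturation.\<close>

lemma openin_E:
  assumes "open U"
  shows "openin (top_of_set (range E)) (E ` U)"
proof -
  let ?V = "\<Union>s\<in>S. \<Union>v\<in>int_lattice. (\<lambda>y. s * (y - (2 * pi) *\<^sub>R v)) -` U"
  have "open ((\<lambda>y. s * (y - (2 * pi) *\<^sub>R v)) -` U)" for s v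
  proof (rule open_vimage[OF assms])
    show "continuous_on UNIV (\<lambda>y. s * (y - (2 * pi) *\<^sub>R v))"
      by (intro continuous_on_compose2[OF linear_continuous_on[OF bounded_linear_mult_vec]] continuous_intros) auto
  qed
  then have oV: "open ?V" by (intro open_UN ballI)
  have V: "?V = E -` (E ` U)"
  proof (intro equalityI subsetI)
    fix y assume "y \<in> ?V"
    then obtain s v where sv: "s \<in> S" "v \<in> int_lattice" "s * (y - (2 * pi) *\<^sub>R v) \<in> U" by auto
    have "E (s * (y - (2 * pi) *\<^sub>R v)) = E y"
      unfolding E_eq by (rule bexI[OF _ sv(1)], rule bexI[OF _ sv(2)]) (simp add: S_cancel[OF sv(1)])
    then have "E y \<in> E ` U" using sv(3) by (metis imageI)
    then show "y \<in> E -` (E ` U)" by simp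
  next
    fix y assume "y \<in> E -` (E ` U)"
    then obtain x where x: "x \<in> U" "E x = E y" by auto
    then obtain s v where sv: "s \<in> S" "v \<in> int_lattice" "y = (2 * pi) *\<^sub>R v + s * x" unfolding E_eq by blast
    then have "s * (y - (2 * pi) *\<^sub>R v) = x" by (simp add: S_cancel)
    then show "y \<in> ?V" using sv x(1) by (intro UN_I[OF sv(1)] UN_I[OF sv(2)]) simp
  qed
  have "compact (period_box - ?V)" using oV by (intro compact_diff compact_cbox)
  then have "compact (E ` (period_box - ?V))" by (intro compact_continuous_image E_cont)
  then have "open (- E ` (period_box - ?V))" by (simp add: compact_imp_closed open_Compl)
  moreover have "E ` U = range E \<inter> - E ` (period_box - ?V)"
  proof (intro equalityI subsetI)
    fix z assume z: "z \<in> E ` U"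
    have "E x \<notin> E ` U" if "x \<in> period_box - ?V" for x
      using that unfolding V by simp
    then show "z \<in> range E \<inter> - E ` (period_box - ?V)" using z by blast
  next
    fix z assume z: "z \<in> range E \<inter> - E ` (period_box - ?V)"
    then obtain x where x: "x \<in> period_box" "z = E x" using E_period_box by blast
    then have "x \<in> ?V" using z by blast
    then have "E x \<in> E ` U" unfolding V by simp
    then show "z \<in> E ` U" using x(2) by simp
  qed
  ultimately show ?thesis by (auto simp: openin_open)
qed

definition orbit_proj :: "real^'n \<Rightarrow> real" where
  "orbit_proj x = real_code (E x)"

definition orbit_space :: "real topology" where
  "orbit_space = code_topology (range E)"

lemma orbit_proj_eq_iff:
  "orbit_proj x = orbit_proj y \<longleftrightarrow> (\<exists>s\<in>S. \<exists>v\<in>int_lattice. y = (2 * pi) *\<^sub>R v + s * x)"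
  unfolding orbit_proj_def real_code_eq_iff by (rule E_eq)

lemma topspace_orbit_space: "topspace orbit_space = range orbit_proj"
  unfolding orbit_space_def topspace_code_topology orbit_proj_def by auto

lemma orbit_space_homeomorphic: "top_of_set (range E) homeomorphic_space orbit_space"
  unfolding orbit_space_def using homeomorphic_map_real_code homeomorphic_map_imp_homeomorphic_space by blast

lemma openin_orbit_proj: "open U \<Longrightarrow> openin orbit_space (orbit_proj ` U)"
  using openin_code_topology[OF openin_E] unfolding orbit_space_def orbit_proj_def by (simp add: image_image)

lemma continuous_orbit_proj: "continuous_map (top_of_set A) orbit_space orbit_proj"
proof -
  have "continuous_map (top_of_set A) (top_of_set (range E)) E"
    using E_cont[of A] by (auto simp: continuous_map_in_subtopology)
  moreover have "continuous_map (top_of_set (range E)) orbit_space real_code"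
    unfolding orbit_space_def by (rule homeomorphic_imp_continuous_map[OF homeomorphic_map_real_code])
  ultimately have "continuous_map (top_of_set A) orbit_space (real_code \<circ> E)" by (rule continuous_map_compose)
  then show ?thesis by (simp add: orbit_proj_def[abs_def] o_def)
qed

lemma quotient_map_orbit_proj:
  assumes "open U"
  shows "quotient_map (top_of_set U) (subtopology orbit_space (orbit_proj ` U)) orbit_proj"
proof (rule continuous_open_imp_quotient_map)
  show "continuous_map (top_of_set U) (subtopology orbit_space (orbit_proj ` U)) orbit_proj"
    using continuous_orbit_proj by (auto simp: continuous_map_in_subtopology)
  show "open_map (top_of_set U) (subtopology orbit_space (orbit_proj ` U)) orbit_proj"
    unfolding open_map_def
  proof (intro allI impI)
    fix V assume "openin (top_of_set U) V"
    then have "open V" "V \<subseteq> U" using assms openin_open_eq by auto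
    then show "openin (subtopology orbit_space (orbit_proj ` U)) (orbit_proj ` V)"
      using openin_orbit_proj[of V] by (intro subset_openin_subtopology image_mono)
  qed
  show "orbit_proj ` topspace (top_of_set U) = topspace (subtopology orbit_space (orbit_proj ` U))"
    by (auto simp: topspace_orbit_space)
qed

text \<open>The linear parts of the group elements fixing \<open>a\<close>. Each of them occurs for only one such element,
  namely \<open>x \<mapsto> a + s * (x - a)\<close>.\<close>

definition fixing :: "real^'n \<Rightarrow> (real^'n) set" where
  "fixing a = {s \<in> S. \<exists>v\<in>int_lattice. a = (2 * pi) *\<^sub>R v + s * a}"

definition chart :: "real^'n \<Rightarrow> real \<Rightarrow> (real, 'n) orb_chart" where
  "chart a r = \<lparr>cover = ball a r,
     grp = (\<lambda>s. restrict (\<lambda>x. a + s * (x - a)) (ball a r)) ` fixing a,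
     proj = orbit_proj\<rparr>"

text \<open>The condition under which the stabiliser of the centre can serve as the chart group of the ball.\<close>

definition good :: "real^'n \<Rightarrow> real \<Rightarrow> bool" where
  "good a r \<longleftrightarrow> 0 < r \<and> (\<forall>s\<in>S. \<forall>v\<in>int_lattice. \<forall>x\<in>ball a r.
     (2 * pi) *\<^sub>R v + s * x \<in> ball a r \<longrightarrow> a = (2 * pi) *\<^sub>R v + s * a)"

definition orbifold_of :: "(real, 'n) orbifold" where
  "orbifold_of = \<lparr>space_of = orbit_space, atlas = {chart a r | a r. good a r}\<rparr>"

lemma chart_simps [simp]:
  "cover (chart a r) = ball a r" "proj (chart a r) = orbit_proj"
  "grp (chart a r) = (\<lambda>s. restrict (\<lambda>x. a + s * (x - a)) (ball a r)) ` fixing a"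
  "space_of orbifold_of = orbit_space" "atlas orbifold_of = {chart a r | a r. good a r}"
  by (simp_all add: chart_def orbifold_of_def)

lemma good_mono: "good a r \<Longrightarrow> 0 < r' \<Longrightarrow> r' \<le> r \<Longrightarrow> good a r'"
  unfolding good_def using subset_ball[of r' r a] by blast

text \<open>An element that identifies two points of the ball moves the centre by less than the diameter. In each
  coordinate the displacements of the centre lie in one of two arithmetic progressions, so a small
  displacement is zero.\<close>

lemma ex_good: "\<exists>r. good a r"
proof -
  have "\<exists>\<delta>. \<forall>i \<sigma>. 0 < \<delta> i \<sigma> \<and> (\<forall>n::int. \<bar>(\<sigma> - 1) * a $ i + 2 * pi * n\<bar> < \<delta> i \<sigma> \<longrightarrow> (\<sigma> - 1) * a $ i + 2 * pi * n = 0)"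
    using discrete_progression by (intro choice allI) 
  then obtain \<delta> where \<delta>: "\<And>i \<sigma>. 0 < \<delta> i \<sigma>"
    "\<And>i \<sigma> n. \<bar>(\<sigma> - 1) * a $ i + 2 * pi * real_of_int n\<bar> < \<delta> i \<sigma> \<Longrightarrow> (\<sigma> - 1) * a $ i + 2 * pi * n = 0"
    by blast
  define D where "D = Min ((\<lambda>(i, \<sigma>). \<delta> i \<sigma>) ` (UNIV \<times> {1, -1}))"
  have fin: "finite ((\<lambda>(i, \<sigma>). \<delta> i \<sigma>) ` ((UNIV :: 'n set) \<times> {1, -1}))" by simp
  have D: "0 < D" using \<delta>(1) unfolding D_def by (subst Min_gr_iff[OF fin]) auto
  have D_le: "D \<le> \<delta> i \<sigma>" if "\<sigma> = 1 \<or> \<sigma> = -1" for i \<sigma>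
    unfolding D_def using that by (intro Min_le[OF fin] image_eqI[of _ _ "(i, \<sigma>)"]) auto
  have "good a (D / 2)"
    unfolding good_def
  proof (intro conjI ballI impI)
    fix s v x assume s: "s \<in> S" and v: "v \<in> int_lattice"
      and x: "x \<in> ball a (D / 2)" "(2 * pi) *\<^sub>R v + s * x \<in> ball a (D / 2)"
    let ?w = "(2 * pi) *\<^sub>R v + s * a - a"
    have w_eq: "?w = ((2 * pi) *\<^sub>R v + s * x - a) - s * (x - a)" by (simp add: algebra_simps)
    have "norm ?w \<le> norm ((2 * pi) *\<^sub>R v + s * x - a) + norm (s * (x - a))"
      unfolding w_eq by (rule norm_triangle_ineq4)
    also have "\<dots> < D" using x norm_S[OF s] by (simp add: dist_norm norm_minus_commute)
    finally have "norm ?w < D" .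
    have "?w $ i = 0" for i
    proof -
      obtain n where n: "v $ i = of_int n" using v unfolding int_lattice_def by (auto elim: Ints_cases)
      have w: "?w $ i = (s $ i - 1) * a $ i + 2 * pi * n" by (simp add: n algebra_simps)
      have "\<bar>?w $ i\<bar> < \<delta> i (s $ i)"
        using component_le_norm_cart[of ?w i] \<open>norm ?w < D\<close> D_le[OF S_sign[OF s, of i], of i] by linarith
      then show ?thesis unfolding w by (rule \<delta>(2))
    qed
    then have "?w = 0" by (simp add: vec_eq_iff)
    then show "a = (2 * pi) *\<^sub>R v + s * a" by simp
  qed (use D in simp)
  then show ?thesis ..
qed

lemma ex_small_good: "0 < \<epsilon> \<Longrightarrow> \<exists>r. good a r \<and> r \<le> \<epsilon>"
proof -
  assume "0 < \<epsilon>"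
  obtain r where r: "good a r" using ex_good by blast
  then have "0 < r" by (simp add: good_def)
  then have "good a (min r \<epsilon>)" using good_mono[OF r] \<open>0 < \<epsilon>\<close> by simp
  then show ?thesis by (intro exI[of _ "min r \<epsilon>"]) simp
qed

end

context flat_orbifold
begin

lemma fixing_S: "s \<in> fixing a \<Longrightarrow> s \<in> S"
  by (simp add: fixing_def)

lemma fixing_one: "1 \<in> fixing a"
  unfolding fixing_def using S_one int_lattice_0 by (auto intro!: bexI[of _ 0])

lemma int_lattice_sign: "s \<in> S \<Longrightarrow> v \<in> int_lattice \<Longrightarrow> s * v \<in> int_lattice"
proof -
  assume s: "s \<in> S" and v: "v \<in> int_lattice"
  have "s $ i * v $ i \<in> \<int>" for i
    using S_sign[OF s, of i] v unfolding int_lattice_def by auto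
  then show ?thesis by (simp add: int_lattice_def)
qed

lemma fixing_mult:
  assumes "s \<in> fixing a" "t \<in> fixing a"
  shows "s * t \<in> fixing a"
proof -
  obtain v w where v: "v \<in> int_lattice" "a = (2 * pi) *\<^sub>R v + s * a"
    and w: "w \<in> int_lattice" "a = (2 * pi) *\<^sub>R w + t * a"
    using assms unfolding fixing_def by blast
  have sv: "s * ((2 * pi) *\<^sub>R w) = (2 * pi) *\<^sub>R (s * w)" by (simp add: vec_eq_iff)
  have "a = (2 * pi) *\<^sub>R v + s * ((2 * pi) *\<^sub>R w + t * a)" using v(2) w(2) by simp
  also have "\<dots> = (2 * pi) *\<^sub>R (v + s * w) + s * t * a"
    unfolding distrib_left sv by (simp add: scaleR_add_right mult.assoc)
  finally show ?thesis
    using S_mult assms fixing_S int_lattice_add[OF v(1) int_lattice_sign[OF _ w(1)]]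
    unfolding fixing_def by blast
qed

lemma finite_fixing: "finite (fixing a)"
  by (rule finite_subset[OF _ finite_S]) (use fixing_S in blast)

abbreviation rotation :: "real^'n \<Rightarrow> real \<Rightarrow> real^'n \<Rightarrow> real^'n \<Rightarrow> real^'n" where
  "rotation a r s \<equiv> restrict (\<lambda>x. a + s * (x - a)) (ball a r)"

lemma rotation_ball: "s \<in> S \<Longrightarrow> x \<in> ball a r \<Longrightarrow> a + s * (x - a) \<in> ball a r"
  by (simp add: dist_norm norm_S norm_minus_commute)

lemma rotation_compose:
  assumes "t \<in> S"
  shows "compose (ball a r) (rotation a r s) (rotation a r t) = rotation a r (s * t)"
  using rotation_ball[OF assms] by (auto simp: compose_def fun_eq_iff mult.assoc)

lemma rotation_one: "rotation a r 1 = \<one>\<^bsub>BijGroup (ball a r)\<^esub>"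
  by (auto simp: BijGroup_def fun_eq_iff)

lemma rotation_Bij: "s \<in> S \<Longrightarrow> rotation a r s \<in> Bij (ball a r)"
  unfolding Bij_def
  by (auto intro!: bij_betwI[where g = "rotation a r s"] rotation_ball simp: S_cancel)
    (use rotation_ball in auto)

lemma subgroup_rotations: "subgroup (rotation a r ` fixing a) (BijGroup (ball a r))"
proof -
  interpret B: group "BijGroup (ball a r)" by (rule group_BijGroup)
  have carr: "rotation a r s \<in> carrier (BijGroup (ball a r))" if "s \<in> fixing a" for s
    using rotation_Bij[OF fixing_S[OF that]] by (simp add: BijGroup_def)
  have mult: "rotation a r s \<otimes>\<^bsub>BijGroup (ball a r)\<^esub> rotation a r t = rotation a r (s * t)"
    if "s \<in> fixing a" "t \<in> fixing a" for s t
    using rotation_Bij[OF fixing_S[OF that(1)]] rotation_Bij[OF fixing_S[OF that(2)]]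
      rotation_compose[OF fixing_S[OF that(2)]] by (simp add: BijGroup_def)
  show ?thesis
  proof (rule B.subgroupI)
    show "rotation a r ` fixing a \<subseteq> carrier (BijGroup (ball a r))" using carr by blast
    show "rotation a r ` fixing a \<noteq> {}" using fixing_one by blast
    fix f assume "f \<in> rotation a r ` fixing a"
    then obtain s where s: "s \<in> fixing a" "f = rotation a r s" by blast
    have "f \<otimes>\<^bsub>BijGroup (ball a r)\<^esub> f = \<one>\<^bsub>BijGroup (ball a r)\<^esub>"
      unfolding s(2) mult[OF s(1) s(1)] S_square[OF fixing_S[OF s(1)]] by (rule rotation_one)
    then have "inv\<^bsub>BijGroup (ball a r)\<^esub> f = f"
      using carr[OF s(1)] s(2) by (intro B.inv_equality) auto
    then show "inv\<^bsub>BijGroup (ball a r)\<^esub> f \<in> rotation a r ` fixing a" using s by blast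
    fix g assume "g \<in> rotation a r ` fixing a"
    then obtain t where t: "t \<in> fixing a" "g = rotation a r t" by blast
    show "f \<otimes>\<^bsub>BijGroup (ball a r)\<^esub> g \<in> rotation a r ` fixing a"
      unfolding s(2) t(2) mult[OF s(1) t(1)] by (rule imageI[OF fixing_mult[OF s(1) t(1)]])
  qed
qed

lemma rotation_affine: "x \<in> ball a r \<Longrightarrow> (a - s * a) + s * x = rotation a r s x"
  by (simp add: algebra_simps)

lemma orbifold_chart_chart:
  assumes "good a r"
  shows "orbifold_chart orbit_space (chart a r)"
  unfolding orbifold_chart_def chart_image_def chart_simps
proof (intro conjI ballI)
  show "finite (rotation a r ` fixing a)" using finite_fixing by blast
  show "subgroup (rotation a r ` fixing a) (BijGroup (ball a r))" by (rule subgroup_rotations)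
  show "openin orbit_space (orbit_proj ` ball a r)" by (intro openin_orbit_proj open_ball)
  show "quotient_map (top_of_set (ball a r)) (subtopology orbit_space (orbit_proj ` ball a r)) orbit_proj"
    by (intro quotient_map_orbit_proj open_ball)
  show "smooth_on (ball a r) \<gamma>" if "\<gamma> \<in> rotation a r ` fixing a" for \<gamma>
  proof -
    from that obtain s where "\<gamma> = rotation a r s" by (rule imageE)
    then show ?thesis
      by (simp only:) (rule smooth_on_cong[OF open_ball rotation_affine smooth_on_affine])
  qed
  fix x y assume x: "x \<in> ball a r" and y: "y \<in> ball a r"
  show "orbit_proj x = orbit_proj y \<longleftrightarrow> (\<exists>\<gamma>\<in>rotation a r ` fixing a. y = \<gamma> x)"
  proof
    assume "orbit_proj x = orbit_proj y"
    then obtain s v where sv: "s \<in> S" "v \<in> int_lattice" "y = (2 * pi) *\<^sub>R v + s * x"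
      unfolding orbit_proj_eq_iff by blast
    then have a: "a = (2 * pi) *\<^sub>R v + s * a" using assms x y unfolding good_def by blast
    have "y = rotation a r s x"
    proof -
      have "y - a = s * (x - a)" using sv(3) a by (simp add: algebra_simps)
      then show ?thesis using x by (simp add: algebra_simps)
    qed
    moreover have "s \<in> fixing a" using sv a unfolding fixing_def by blast
    ultimately show "\<exists>\<gamma>\<in>rotation a r ` fixing a. y = \<gamma> x" by blast
  next
    assume "\<exists>\<gamma>\<in>rotation a r ` fixing a. y = \<gamma> x"
    then obtain s where s: "s \<in> fixing a" "y = a + s * (x - a)" using x by auto
    obtain v where v: "v \<in> int_lattice" "a = (2 * pi) *\<^sub>R v + s * a" using s(1) unfolding fixing_def by blast
    have "a - s * a = (2 * pi) *\<^sub>R v" unfolding diff_eq_eq by (rule v(2))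
    moreover have "y = (a - s * a) + s * x" using s(2) by (simp add: algebra_simps)
    ultimately have "y = (2 * pi) *\<^sub>R v + s * x" by simp
    then show "orbit_proj x = orbit_proj y"
      unfolding orbit_proj_eq_iff using fixing_S[OF s(1)] v(1) by blast
  qed
qed simp_all

lemma chart_embedding_affine:
  assumes s: "s \<in> S" and v: "v \<in> int_lattice"
    and sub: "ball ((2 * pi) *\<^sub>R v + s * u) \<epsilon> \<subseteq> ball b r"
  shows "chart_embedding (chart u \<epsilon>) (chart b r) (\<lambda>x. (2 * pi) *\<^sub>R v + s * x)"
  unfolding chart_embedding_def chart_simps
proof (intro conjI ballI)
  let ?f = "\<lambda>x. (2 * pi) *\<^sub>R v + s * x"
  show "smooth_on (ball u \<epsilon>) ?f" by (rule smooth_on_affine)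
  show "inj_on ?f (ball u \<epsilon>)"
  proof (rule inj_onI)
    fix x y assume "?f x = ?f y"
    then have "s * (s * x) = s * (s * y)" by simp
    then show "x = y" by (simp only: S_cancel[OF s])
  qed
  show "?f ` ball u \<epsilon> \<subseteq> ball b r"
  proof
    fix y assume "y \<in> ?f ` ball u \<epsilon>"
    then obtain x where x: "x \<in> ball u \<epsilon>" "y = ?f x" by blast
    have "dist (?f u) y = norm (s * (u - x))" unfolding x(2) dist_norm by (simp add: right_diff_distrib)
    then have "y \<in> ball (?f u) \<epsilon>" using x(1) norm_S[OF s] by (simp add: dist_norm)
    then show "y \<in> ball b r" using sub by blast
  qed
  fix x
  show "det (jacobian_matrix ?f x) \<noteq> 0"
    unfolding jacobian_matrix_affine det_diag_mat S_det[OF s] by simp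
  have "orbit_proj x = orbit_proj (?f x)" unfolding orbit_proj_eq_iff using s v by blast
  then show "orbit_proj (?f x) = orbit_proj x" by simp
qed

text \<open>A small good ball around a point of the first chart embeds in the first chart by inclusion and in the
  second by the group element that carries the point there.\<close>

lemma compatible_charts:
  assumes x: "x \<in> chart_image (chart a r) \<inter> chart_image (chart b r')"
  shows "\<exists>e f g. orbifold_chart orbit_space e \<and> x \<in> chart_image e \<and>
    chart_embedding e (chart a r) f \<and> chart_embedding e (chart b r') g"
proof -
  obtain u where u: "u \<in> ball a r" "x = orbit_proj u" using x unfolding chart_image_def by auto
  obtain v where v: "v \<in> ball b r'" "x = orbit_proj v" using x unfolding chart_image_def by auto
  have "orbit_proj u = orbit_proj v" using u v by simp
  then obtain s w where sw: "s \<in> S" "w \<in> int_lattice" "v = (2 * pi) *\<^sub>R w + s * u"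
    unfolding orbit_proj_eq_iff by blast
  obtain \<epsilon>1 where e1: "0 < \<epsilon>1" "ball u \<epsilon>1 \<subseteq> ball a r" using openE[OF open_ball u(1)] by blast
  obtain \<epsilon>2 where e2: "0 < \<epsilon>2" "ball v \<epsilon>2 \<subseteq> ball b r'" using openE[OF open_ball v(1)] by blast
  obtain \<epsilon> where e: "good u \<epsilon>" "\<epsilon> \<le> min \<epsilon>1 \<epsilon>2" using ex_small_good[of "min \<epsilon>1 \<epsilon>2" u] e1 e2 by auto
  have "ball ((2 * pi) *\<^sub>R 0 + 1 * u) \<epsilon> \<subseteq> ball a r" using e1(2) e(2) by auto
  from chart_embedding_affine[OF S_one int_lattice_0 this]
  have f: "chart_embedding (chart u \<epsilon>) (chart a r) (\<lambda>x. (2 * pi) *\<^sub>R 0 + 1 * x)" .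
  have "ball ((2 * pi) *\<^sub>R w + s * u) \<epsilon> \<subseteq> ball b r'" using e2(2) e(2) sw(3) by auto
  from chart_embedding_affine[OF sw(1,2) this]
  have g: "chart_embedding (chart u \<epsilon>) (chart b r') (\<lambda>x. (2 * pi) *\<^sub>R w + s * x)" .
  have "u \<in> ball u \<epsilon>" using e(1) by (simp add: good_def)
  then have "x \<in> chart_image (chart u \<epsilon>)" using u(2) unfolding chart_image_def by simp
  then show ?thesis using orbifold_chart_chart[OF e(1)] f g by blast
qed

lemma is_orbifold: "is_orbifold orbifold_of"
  unfolding is_orbifold_def chart_simps
proof (intro conjI ballI)
  show "Hausdorff_space orbit_space"
    using homeomorphic_Hausdorff_space[OF orbit_space_homeomorphic] Hausdorff_space_subtopology Hausdorff_space_euclidean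
    by blast
  obtain \<B> :: "(complex^'n) set set" where "countable \<B>" "\<And>C. C \<in> \<B> \<Longrightarrow> open C"
    "\<And>S. open S \<Longrightarrow> \<exists>U. U \<subseteq> \<B> \<and> S = \<Union>U"
    using univ_second_countable by blast
  then have "second_countable (euclidean :: (complex^'n) topology)"
    unfolding second_countable_def open_openin[symmetric] by (intro exI[of _ \<B>]) blast
  then show "second_countable orbit_space"
    using homeomorphic_space_second_countability[OF orbit_space_homeomorphic] second_countable_subtopology by blast
  show "orbifold_chart orbit_space c" if "c \<in> {chart a r |a r. good a r}" for c
    using that orbifold_chart_chart by blast
  show "(\<Union>c\<in>{chart a r |a r. good a r}. chart_image c) = topspace orbit_space"
    unfolding topspace_orbit_space
  proof (intro equalityI subsetI)
    fix x assume "x \<in> range orbit_proj"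
    then obtain u where u: "x = orbit_proj u" by blast
    obtain r where r: "good u r" using ex_good by blast
    then have "u \<in> ball u r" by (simp add: good_def)
    then have "x \<in> chart_image (chart u r)" using u unfolding chart_image_def by simp
    then show "x \<in> (\<Union>c\<in>{chart a r |a r. good a r}. chart_image c)" using r by blast
  qed (auto simp: chart_image_def)
  fix c d x assume "c \<in> {chart a r |a r. good a r}" "d \<in> {chart a r |a r. good a r}"
    "x \<in> chart_image c \<inter> chart_image d"
  then show "\<exists>e f g. orbifold_chart orbit_space e \<and> x \<in> chart_image e \<and> chart_embedding e c f \<and> chart_embedding e d g"
    using compatible_charts by blast
qed

lemma closed_orbifold: "closed_orbifold orbifold_of"
  unfolding closed_orbifold_def chart_simps
proof (intro conjI is_orbifold)
  show "compact_space orbit_space"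
    using homeomorphic_compact_space[OF orbit_space_homeomorphic] compact_range_E
    by (simp add: compact_space_subtopology)
  have "connected (range E)" by (intro connected_continuous_image E_cont connected_UNIV)
  then show "connected_space orbit_space"
    using homeomorphic_connected_space[OF orbit_space_homeomorphic]
    by (simp add: connected_space_subtopology)
qed

end

section \<open>Orientation and flat metrics\<close>

lemma diag_mat_mult: "diag_mat a ** diag_mat b = diag_mat (a * b)"
  by (simp add: diag_mat_def matrix_matrix_mult_def vec_eq_iff if_distrib[of "\<lambda>c. c * _"] cong: if_cong)

lemma diag_mat_one: "diag_mat 1 = mat 1"
  by (simp add: diag_mat_def mat_def vec_eq_iff)

lemma transpose_diag_mat: "transpose (diag_mat a) = diag_mat a"
  by (auto simp: diag_mat_def transpose_def vec_eq_iff)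

lemma matrix_inv_diag_mat:
  assumes "\<And>i. d $ i \<noteq> 0"
  shows "matrix_inv (diag_mat d) = diag_mat (\<chi> i. 1 / d $ i)"
proof -
  let ?B = "diag_mat (\<chi> i. 1 / d $ i)"
  have "d * (\<chi> i. 1 / d $ i) = 1" using assms by (simp add: vec_eq_iff)
  then have B: "diag_mat d ** ?B = mat 1 \<and> ?B ** diag_mat d = mat 1"
    by (simp add: diag_mat_mult diag_mat_one mult.commute)
  then have "matrix_inv (diag_mat d) ** diag_mat d = mat 1"
    unfolding matrix_inv_def by (rule someI2) blast
  then have "(matrix_inv (diag_mat d) ** diag_mat d) ** ?B = ?B" by simp
  then show ?thesis using B by (simp add: matrix_mul_assoc[symmetric])
qed

lemma partial_deriv_mult_const:
  fixes f :: "real^'n::finite \<Rightarrow> real"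
  assumes "f differentiable (at u)"
  shows "partial_deriv i (\<lambda>x. c * f x) u = c * partial_deriv i f u"
proof -
  have "((\<lambda>x. c * f x) has_derivative (\<lambda>h. c * frechet_derivative f (at u) h)) (at u)"
    by (rule has_derivative_mult_right[OF frechet_derivative_works[THEN iffD1, OF assms]])
  from partial_deriv_eqI[OF this] show ?thesis by (simp add: partial_deriv_def)
qed

lemma local_laplacian_diag_mat:
  fixes f :: "real^'n::finite \<Rightarrow> real"
  assumes d: "\<And>i. 0 < d $ i" and U: "open U" "u \<in> U" and f: "smooth_on U f"
  shows "local_laplacian (\<lambda>_. diag_mat d) f u = - (\<Sum>i\<in>UNIV. (1 / d $ i) * partial_deriv i (partial_deriv i f) u)"
proof -
  let ?K = "sqrt (det (diag_mat d))"
  have K: "?K > 0" unfolding det_diag_mat using d by (simp add: prod_pos)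
  have inv: "matrix_inv (diag_mat d) = diag_mat (\<chi> i. 1 / d $ i)"
    using d by (intro matrix_inv_diag_mat) (simp add: less_imp_neq[symmetric])
  have pd: "partial_deriv i (\<lambda>v. c * partial_deriv j f v) u = c * partial_deriv i (partial_deriv j f) u" for c i j
    using smooth_on_differentiable[OF smooth_on_partial_deriv[OF f]] differentiable_on_eq_differentiable_at[OF U(1)] U(2)
    by (intro partial_deriv_mult_const) blast
  have "(\<Sum>j\<in>UNIV. partial_deriv i (\<lambda>v. ?K * matrix_inv (diag_mat d) $ i $ j * partial_deriv j f v) u)
      = ?K * ((1 / d $ i) * partial_deriv i (partial_deriv i f) u)" for i
    unfolding pd inv
    by (simp add: diag_mat_def if_distrib[of "\<lambda>c. c * _"] if_distrib[of "\<lambda>c. _ * c"] cong: if_cong)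
  then have "local_laplacian (\<lambda>_. diag_mat d) f u =
      - (1 / ?K) * (\<Sum>i\<in>UNIV. ?K * ((1 / d $ i) * partial_deriv i (partial_deriv i f) u))"
    unfolding local_laplacian_def by simp
  then show ?thesis unfolding sum_distrib_left[symmetric] using K by simp
qed

lemma closed_same_det: "closed {(A :: real^'n^'n::finite, B :: real^'n^'n). det A = det B}"
proof -
  have "closed {p :: (real^'n^'n) \<times> (real^'n^'n). det (fst p) = det (snd p)}"
    unfolding det_def by (intro closed_Collect_eq continuous_intros)
  then show ?thesis by (simp add: split_def)
qed

lemma closed_same_pullback:
  "closed {(A :: real^'n^'n::finite, B :: real^'n^'n). transpose A ** D ** A = transpose B ** D ** B}"
proof -
  have "closed {p :: (real^'n^'n) \<times> (real^'n^'n). transpose (fst p) ** D ** fst p = transpose (snd p) ** D ** snd p}"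
    unfolding matrix_matrix_mult_def transpose_def
    by (intro closed_Collect_eq continuous_intros continuous_on_vec_lambda)
  then show ?thesis by (simp add: split_def)
qed

context flat_orbifold
begin

lemma embeddings_orbit:
  assumes "c \<in> atlas orbifold_of" "d \<in> atlas orbifold_of"
    and "chart_embedding e c f" "chart_embedding e d g" and "x \<in> cover e"
  shows "\<exists>s\<in>S. \<exists>v\<in>int_lattice. g x = (2 * pi) *\<^sub>R v + s * f x"
proof -
  have "proj c = orbit_proj" "proj d = orbit_proj" using assms(1,2) by auto
  then have "orbit_proj (f x) = orbit_proj (g x)" using assms(3-5) unfolding chart_embedding_def by simp
  then show ?thesis unfolding orbit_proj_eq_iff .
qed

text \<open>All statements on changes of charts are instances of this one, with different sets \<open>Z\<close>.\<close>

lemma embeddings_closed_relation: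
  assumes "c \<in> atlas orbifold_of" "d \<in> atlas orbifold_of" and e: "orbifold_chart X e"
    and f: "chart_embedding e c f" and g: "chart_embedding e d g" and u: "u \<in> cover e"
    and Z: "closed Z" "\<And>A s. s \<in> S \<Longrightarrow> (A, diag_mat s ** A) \<in> Z"
  shows "(jacobian_matrix f u, jacobian_matrix g u) \<in> Z"
proof (rule jacobian_closed_relation[OF _ _ _ finite_S _ Z u])
  show "open (cover e)" using e by (simp add: orbifold_chart_def)
  show "smooth_on (cover e) f" "smooth_on (cover e) g" using f g by (simp_all add: chart_embedding_def)
  show "\<exists>s\<in>S. \<exists>v\<in>int_lattice. g x = (2 * pi) *\<^sub>R v + s * f x" if "x \<in> cover e" for x
    by (rule embeddings_orbit[OF assms(1,2) f g that])
qed

lemma oriented: "oriented orbifold_of"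
  unfolding oriented_def
proof (intro conjI ballI allI impI)
  fix c \<gamma> u assume c: "c \<in> atlas orbifold_of" and \<gamma>: "\<gamma> \<in> grp c" and u: "u \<in> cover c"
  obtain a r where ar: "c = chart a r" using c by auto
  then obtain s where s: "s \<in> fixing a" "\<gamma> = rotation a r s" using \<gamma> by auto
  have u': "u \<in> ball a r" using u ar by simp
  have "jacobian_matrix \<gamma> u = jacobian_matrix (\<lambda>x. (a - s * a) + s * x) u"
    unfolding jacobian_matrix_def s(2)
    by (rule arg_cong[where f = matrix], rule frechet_derivative_cong_open[OF open_ball u', symmetric])
      (rule rotation_affine)
  then show "0 < det (jacobian_matrix \<gamma> u)"
    by (simp add: jacobian_matrix_affine det_diag_mat S_det[OF fixing_S[OF s(1)]])
next
  fix c d e f g u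
  assume c: "c \<in> atlas orbifold_of" "d \<in> atlas orbifold_of"
    and e: "orbifold_chart (space_of orbifold_of) e"
    and f: "chart_embedding e c f" and g: "chart_embedding e d g" and u: "u \<in> cover e"
  have "(jacobian_matrix f u, jacobian_matrix g u) \<in> {(A, B). det A = det B}"
    by (rule embeddings_closed_relation[OF c e f g u closed_same_det])
      (simp add: det_mul det_diag_mat S_det)
  then have "det (jacobian_matrix f u) = det (jacobian_matrix g u)" by simp
  moreover have "det (jacobian_matrix f u) \<noteq> 0" using f u by (simp add: chart_embedding_def)
  ultimately show "0 < det (jacobian_matrix f u) * det (jacobian_matrix g u)"
    using not_square_less_zero[of "det (jacobian_matrix g u)"] by (simp add: less_le)
qed

lemma flat_metric:
  assumes d: "\<And>i. 0 < d $ i"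
  shows "riemannian_metric_on orbifold_of T (\<lambda>_ _. diag_mat d)"
  unfolding riemannian_metric_on_def
proof (intro conjI ballI allI impI)
  show "smooth_on A (\<lambda>_. diag_mat d)" for A :: "(real^'n) set" by (rule smooth_on_const)
  show "transpose (diag_mat d) = diag_mat d" by (rule transpose_diag_mat)
  fix v :: "real^'n" assume "v \<noteq> 0"
  then obtain i where i: "v $ i \<noteq> 0" by (auto simp: vec_eq_iff)
  have "v \<bullet> (diag_mat d *v v) = (\<Sum>i\<in>UNIV. d $ i * (v $ i)\<^sup>2)"
    unfolding diag_mat_vector inner_vec_def by (simp add: power2_eq_square mult_ac)
  moreover have "0 < (\<Sum>i\<in>UNIV. d $ i * (v $ i)\<^sup>2)"
    using d i by (intro sum_pos2[of _ i]) (auto simp: less_imp_le)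
  ultimately show "0 < v \<bullet> (diag_mat d *v v)" by simp
next
  fix c c' e f g u
  assume c: "c \<in> atlas orbifold_of" "c' \<in> atlas orbifold_of"
    and e: "orbifold_chart (space_of orbifold_of) e"
    and f: "chart_embedding e c f" and g: "chart_embedding e c' g" and u: "u \<in> cover e"
  have "(jacobian_matrix f u, jacobian_matrix g u) \<in>
      {(A, B). transpose A ** diag_mat d ** A = transpose B ** diag_mat d ** B}"
  proof (rule embeddings_closed_relation[OF c e f g u closed_same_pullback])
    fix A :: "real^'n^'n" and s assume s: "s \<in> S"
    have "transpose (diag_mat s ** A) ** diag_mat d ** (diag_mat s ** A) =
        transpose A ** (diag_mat s ** diag_mat d ** diag_mat s) ** A"
      by (simp add: matrix_transpose_mul transpose_diag_mat matrix_mul_assoc)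
    also have "diag_mat s ** diag_mat d ** diag_mat s = diag_mat d"
      unfolding diag_mat_mult using S_square[OF s] by (simp add: mult.commute mult.left_commute)
    finally show "(A, diag_mat s ** A) \<in> {(A, B). transpose A ** diag_mat d ** A = transpose B ** diag_mat d ** B}"
      by simp
  qed
  then show "transpose (jacobian_matrix f u) ** diag_mat d ** jacobian_matrix f u =
      transpose (jacobian_matrix g u) ** diag_mat d ** jacobian_matrix g u" by simp
qed

text \<open>All charts have the same projection and the same constant metric, so the local conditions are
  conditions on the lift to \<open>\<real>\<^sup>n\<close>.\<close>

lemma eigenspace_flat_metric:
  assumes d: "\<And>i. 0 < d $ i"
  shows "eigenspace orbifold_of (\<lambda>_ _. diag_mat d) \<mu> =
    {\<phi>. (\<forall>x. x \<notin> range orbit_proj \<longrightarrow> \<phi> x = 0) \<and> smooth_on UNIV (\<phi> \<circ> orbit_proj) \<and>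
      (\<forall>u. - (\<Sum>i\<in>UNIV. (1 / d $ i) * partial_deriv i (partial_deriv i (\<phi> \<circ> orbit_proj)) u)
        = \<mu> * \<phi> (orbit_proj u))}"
proof -
  have "(\<forall>c\<in>atlas orbifold_of. smooth_on (cover c) (\<phi> \<circ> proj c) \<and>
      (\<forall>u\<in>cover c. local_laplacian (\<lambda>_. diag_mat d) (\<phi> \<circ> proj c) u = \<mu> * \<phi> (proj c u))) \<longleftrightarrow>
    smooth_on UNIV (\<phi> \<circ> orbit_proj) \<and>
      (\<forall>u. - (\<Sum>i\<in>UNIV. (1 / d $ i) * partial_deriv i (partial_deriv i (\<phi> \<circ> orbit_proj)) u)
        = \<mu> * \<phi> (orbit_proj u))" (is "?L \<longleftrightarrow> ?R") for \<phi>
  proof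
    assume L: ?L
    have chart_at: "smooth_on (ball a r) (\<phi> \<circ> orbit_proj)"
      "u \<in> ball a r \<Longrightarrow> local_laplacian (\<lambda>_. diag_mat d) (\<phi> \<circ> orbit_proj) u = \<mu> * \<phi> (orbit_proj u)"
      if "good a r" for a r u
    proof -
      have "chart a r \<in> atlas orbifold_of" using that by auto
      from bspec[OF L this] show "smooth_on (ball a r) (\<phi> \<circ> orbit_proj)"
        "u \<in> ball a r \<Longrightarrow> local_laplacian (\<lambda>_. diag_mat d) (\<phi> \<circ> orbit_proj) u = \<mu> * \<phi> (orbit_proj u)"
        by simp_all
    qed
    have at: "\<exists>r. good u r \<and> u \<in> ball u r" for u using ex_good[of u] by (auto simp: good_def)
    show ?R
    proof (intro conjI allI)
      show "smooth_on UNIV (\<phi> \<circ> orbit_proj)"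
        unfolding smooth_on_def
      proof (intro allI Ck_on_locally)
        fix k u
        obtain r where "good u r" "u \<in> ball u r" using at by blast
        then show "\<exists>U. open U \<and> u \<in> U \<and> Ck_on k U (\<phi> \<circ> orbit_proj)"
          using chart_at(1)[of u r] unfolding smooth_on_def by (intro exI[of _ "ball u r"]) simp
      qed
      fix u
      obtain r where r: "good u r" "u \<in> ball u r" using at by blast
      show "- (\<Sum>i\<in>UNIV. (1 / d $ i) * partial_deriv i (partial_deriv i (\<phi> \<circ> orbit_proj)) u) = \<mu> * \<phi> (orbit_proj u)"
        using chart_at(2)[OF r] local_laplacian_diag_mat[OF d open_ball r(2) chart_at(1)[OF r(1)]] by simp
    qed
  next
    assume R: ?R
    show ?L
    proof (intro ballI conjI)
      fix c assume c: "c \<in> atlas orbifold_of"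
      then have p: "proj c = orbit_proj" by auto
      show "smooth_on (cover c) (\<phi> \<circ> proj c)" unfolding p using R smooth_on_subset by blast
      fix u
      show "local_laplacian (\<lambda>_. diag_mat d) (\<phi> \<circ> proj c) u = \<mu> * \<phi> (proj c u)"
        unfolding p using R local_laplacian_diag_mat[OF d open_UNIV UNIV_I, of "\<phi> \<circ> orbit_proj" u] by simp
    qed
  qed
  then show ?thesis unfolding eigenspace_def chart_simps topspace_orbit_space by auto
qed

end

section \<open>The spectrum of a flat orbifold\<close>

interpretation real_functions: vector_space "scale_fun :: real \<Rightarrow> ('a \<Rightarrow> real) \<Rightarrow> 'a \<Rightarrow> real"
  by (rule vector_space_scale_fun)

interpretation real_functions_pair:
  vector_space_pair "scale_fun :: real \<Rightarrow> ('a \<Rightarrow> real) \<Rightarrow> 'a \<Rightarrow> real"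
    "scale_fun :: real \<Rightarrow> ('b \<Rightarrow> real) \<Rightarrow> 'b \<Rightarrow> real"
  by unfold_locales

text \<open>The maps are mutually inverse on the generating sets \<open>A\<close> and \<open>B\<close>, hence on their spans.\<close>

lemma dim_eq_of_inverse_linear_maps:
  fixes A :: "('a \<Rightarrow> real) set" and B :: "('b \<Rightarrow> real) set"
  assumes T: "Vector_Spaces.linear scale_fun scale_fun T" "Vector_Spaces.linear scale_fun scale_fun T'"
    and TA: "\<And>\<phi>. \<phi> \<in> A \<Longrightarrow> T \<phi> \<in> B" and TB: "\<And>\<psi>. \<psi> \<in> B \<Longrightarrow> T' \<psi> \<in> A"
    and inv: "\<And>\<phi>. \<phi> \<in> A \<Longrightarrow> T' (T \<phi>) = \<phi>" "\<And>\<psi>. \<psi> \<in> B \<Longrightarrow> T (T' \<psi>) = \<psi>"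
  shows "real_functions.dim A = real_functions.dim B"
proof -
  obtain b where b: "b \<subseteq> A" "real_functions.independent b" "A \<subseteq> real_functions.span b"
    "card b = real_functions.dim A"
    using real_functions.basis_exists by blast
  have span_b: "real_functions.span b = real_functions.span A"
    using b by (intro subset_antisym real_functions.span_mono real_functions.span_minimal) auto
  have retract: "T' (T \<phi>) = \<phi>" if "\<phi> \<in> real_functions.span b" for \<phi>
  proof -
    have "(T' \<circ> T) \<phi> = id \<phi>"
    proof (rule real_functions_pair.linear_eq_on[OF _ _ that])
      show "Vector_Spaces.linear scale_fun scale_fun (T' \<circ> T)" by (rule Vector_Spaces.linear_compose[OF T])
      show "Vector_Spaces.linear scale_fun scale_fun (id :: ('a \<Rightarrow> real) \<Rightarrow> _)"
        by (rule real_functions.linear_id)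
      show "(T' \<circ> T) \<psi> = id \<psi>" if "\<psi> \<in> b" for \<psi> using inv(1) b(1) that by auto
    qed
    then show ?thesis by simp
  qed
  have inj: "inj_on T (real_functions.span b)" by (rule inj_on_inverseI[of _ T' T]) (rule retract)
  have B: "T ` A = B"
  proof
    show "B \<subseteq> T ` A" using TB inv(2) by (metis imageI subsetI)
  qed (use TA in blast)
  have "real_functions.independent (T ` b)"
    by (rule real_functions_pair.linear_independent_injective_image[OF T(1) b(2) inj])
  moreover have "real_functions.span (T ` b) = real_functions.span B"
    unfolding real_functions_pair.linear_span_image[OF T(1)] B[symmetric] span_b ..
  ultimately have "real_functions.dim B = card (T ` b)"
    by (intro real_functions.dim_eq_card)
  also have "\<dots> = card b"
    by (rule card_image[OF inj_on_subset[OF inj real_functions.span_superset]])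
  finally show ?thesis using b(4) by simp
qed

lemma dim_pos:
  fixes V :: "('a \<Rightarrow> real) set"
  assumes "V \<subseteq> real_functions.span W" "finite W" "\<phi> \<in> V" "\<phi> \<noteq> 0"
  shows "1 \<le> real_functions.dim V"
proof -
  obtain b where b: "b \<subseteq> V" "real_functions.independent b" "V \<subseteq> real_functions.span b"
    "card b = real_functions.dim V"
    using real_functions.basis_exists by blast
  have "finite b"
    using real_functions.independent_span_bound[OF assms(2) b(2)] b(1) assms(1) by blast
  moreover have "b \<noteq> {}" using assms(3,4) b(3) by auto
  ultimately show ?thesis using b(4) card_gt_0_iff[of b] by linarith
qed

lemma le_spectral_count_squares:
  assumes discrete: "\<And>C. finite {\<mu>. 0 < \<mu> \<and> \<mu> \<le> C \<and> d \<mu> \<noteq> 0}"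
    and squares: "\<And>j::nat. 1 \<le> j \<Longrightarrow> 1 \<le> d ((real j)\<^sup>2)"
  shows "k \<le> spectral_count d ((real k)\<^sup>2)"
proof -
  let ?A = "{\<mu>. 0 < \<mu> \<and> \<mu> \<le> (real k)\<^sup>2 \<and> d \<mu> \<noteq> 0}"
  have sub: "(\<lambda>j. (real j)\<^sup>2) ` {1..k} \<subseteq> ?A"
  proof
    fix x assume "x \<in> (\<lambda>j. (real j)\<^sup>2) ` {1..k}"
    then obtain j where j: "1 \<le> j" "j \<le> k" "x = (real j)\<^sup>2" by auto
    then show "x \<in> ?A" using squares[of j] by (auto intro: power_mono)
  qed
  have "inj_on (\<lambda>j. (real j)\<^sup>2) {1..k}" by (rule inj_onI) simp
  then have "k = card ((\<lambda>j. (real j)\<^sup>2) ` {1..k})" by (simp add: card_image)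
  also have "\<dots> \<le> card ?A" by (rule card_mono[OF discrete sub])
  also have "\<dots> = (\<Sum>\<mu>\<in>?A. 1)" by simp
  also have "\<dots> \<le> spectral_count d ((real k)\<^sup>2)"
    unfolding spectral_count_def by (rule sum_mono) simp
  finally show ?thesis .
qed

abbreviation weight_metric :: "('n::finite \<Rightarrow> real) \<Rightarrow> (real, 'n) metric" where
  "weight_metric w \<equiv> \<lambda>_ _. diag_mat (\<chi> i. 1 / w i)"

context flat_orbifold
begin

definition section_of :: "real \<Rightarrow> real^'n" where
  "section_of = inv_into UNIV orbit_proj"

lemma orbit_proj_section: "x \<in> range orbit_proj \<Longrightarrow> orbit_proj (section_of x) = x"
  unfolding section_of_def by (rule f_inv_into_f)

text \<open>The function on the quotient with lift \<open>F\<close>, if \<open>F\<close> is invariant. For other \<open>F\<close> it depends on the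
  chosen representatives of the orbits, but still linearly on \<open>F\<close>.\<close>

definition descend :: "(real^'n \<Rightarrow> real) \<Rightarrow> real \<Rightarrow> real" where
  "descend F x = (if x \<in> range orbit_proj then F (section_of x) else 0)"

lemma descend_orbit_proj:
  assumes "\<And>s v x. s \<in> S \<Longrightarrow> v \<in> int_lattice \<Longrightarrow> F ((2 * pi) *\<^sub>R v + s * x) = F x"
  shows "descend F \<circ> orbit_proj = F"
proof
  fix x
  have "orbit_proj x = orbit_proj (section_of (orbit_proj x))" by (simp add: orbit_proj_section)
  then obtain s v where "s \<in> S" "v \<in> int_lattice" "section_of (orbit_proj x) = (2 * pi) *\<^sub>R v + s * x"
    unfolding orbit_proj_eq_iff by blast
  then show "(descend F \<circ> orbit_proj) x = F x" using assms by (simp add: descend_def)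
qed

lemma descend_lift: "(\<And>x. x \<notin> range orbit_proj \<Longrightarrow> \<phi> x = 0) \<Longrightarrow> descend (\<phi> \<circ> orbit_proj) = \<phi>"
  by (auto simp: descend_def fun_eq_iff orbit_proj_section)

lemma lift_invariant: "s \<in> S \<Longrightarrow> v \<in> int_lattice \<Longrightarrow> (\<phi> \<circ> orbit_proj) ((2 * pi) *\<^sub>R v + s * x) = (\<phi> \<circ> orbit_proj) x"
  using orbit_proj_eq_iff[of x "(2 * pi) *\<^sub>R v + s * x"] by auto

definition lifts :: "('n \<Rightarrow> real) \<Rightarrow> real \<Rightarrow> (real^'n \<Rightarrow> real) set" where
  "lifts w \<mu> = {F. smooth_on UNIV F \<and>
     (\<forall>x. - (\<Sum>i\<in>UNIV. w i * partial_deriv i (partial_deriv i F) x) = \<mu> * F x) \<and>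
     (\<forall>s\<in>S. \<forall>v\<in>int_lattice. \<forall>x. F ((2 * pi) *\<^sub>R v + s * x) = F x)}"

lemma mem_eigenspace_iff:
  assumes "\<And>i. 0 < w i"
  shows "\<phi> \<in> eigenspace orbifold_of (weight_metric w) \<mu> \<longleftrightarrow>
    (\<forall>x. x \<notin> range orbit_proj \<longrightarrow> \<phi> x = 0) \<and> \<phi> \<circ> orbit_proj \<in> lifts w \<mu>"
proof -
  have "0 < (\<chi> i. 1 / w i) $ i" for i using assms by simp
  note E = eigenspace_flat_metric[OF this, of \<mu>]
  have "\<forall>s\<in>S. \<forall>v\<in>int_lattice. \<forall>x. (\<phi> \<circ> orbit_proj) ((2 * pi) *\<^sub>R v + s * x) = (\<phi> \<circ> orbit_proj) x"
    using lift_invariant[where \<phi> = \<phi>] by blast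
  then show ?thesis unfolding E lifts_def by (simp add: o_def)
qed

lemma descend_mem_eigenspace:
  assumes w: "\<And>i. 0 < w i" and F: "F \<in> lifts w \<mu>"
  shows "descend F \<in> eigenspace orbifold_of (weight_metric w) \<mu>" and "descend F \<circ> orbit_proj = F"
proof -
  show *: "descend F \<circ> orbit_proj = F" using F by (intro descend_orbit_proj) (simp add: lifts_def)
  show "descend F \<in> eigenspace orbifold_of (weight_metric w) \<mu>"
    unfolding mem_eigenspace_iff[where w = w, OF w] * using F by (simp add: descend_def)
qed

lemma lift_expansion:
  assumes w: "\<And>i. 0 < w i" and F: "F \<in> lifts w \<mu>"
  obtains c where "\<And>x. F x = (\<Sum>k\<in>{k \<in> int_lattice. wave_form w k = \<mu>}. Re (c k * character k x))"
proof -
  have sm: "smooth_on UNIV F" using F by (simp add: lifts_def)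
  have diff: "f differentiable (at x)" if "smooth_on UNIV f" for f :: "real^'n \<Rightarrow> real" and x
    using smooth_on_differentiable[OF that] by (simp add: differentiable_on_def)
  have inv: "F ((2 * pi) *\<^sub>R v + 1 * x) = F x" if "v \<in> int_lattice" for v x
    using F S_one that unfolding lifts_def by blast
  have per: "periodic F" unfolding periodic_def using inv[OF int_lattice_axis] by (simp add: add.commute)
  show ?thesis
  proof (rule fourier_expansion[where w = w and F = F and \<mu> = \<mu> and dF = "\<lambda>i. partial_deriv i F" and
        ddF = "\<lambda>i. partial_deriv i (partial_deriv i F)", OF w smooth_on_continuous[OF sm] per])
    show "- (\<Sum>i\<in>UNIV. w i * partial_deriv i (partial_deriv i F) x) = \<mu> * F x" for x
      using F by (simp add: lifts_def)
  qed (auto intro!: partial_deriv_directional diff smooth_on_continuous smooth_on_partial_deriv sm that)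
qed

text \<open>The lift is a combination of real and imaginary parts of finitely many characters. These need not be
  invariant, but evaluating them on the chosen representatives of the orbits gives functions on the
  quotient that span the eigenspace.\<close>

lemma eigenspace_finite_span:
  assumes w: "\<And>i. 0 < w i"
  obtains W where "finite W" "eigenspace orbifold_of (weight_metric w) \<mu> \<subseteq> real_functions.span W"
    "{k \<in> int_lattice. wave_form w k = \<mu>} = {} \<Longrightarrow> W = {}"
proof -
  let ?K = "{k \<in> int_lattice. wave_form w k = \<mu>}"
  let ?c = "\<lambda>k. descend (\<lambda>x. Re (character k x))" and ?s = "\<lambda>k. descend (\<lambda>x. Im (character k x))"
  let ?W = "?c ` ?K \<union> ?s ` ?K"
  have fin: "finite ?K" by (rule finite_wave_form_eq[where w = w, OF w])
  have "\<phi> \<in> real_functions.span ?W" if \<phi>: "\<phi> \<in> eigenspace orbifold_of (weight_metric w) \<mu>" for \<phi>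
  proof -
    have z: "\<And>x. x \<notin> range orbit_proj \<Longrightarrow> \<phi> x = 0" and l: "\<phi> \<circ> orbit_proj \<in> lifts w \<mu>"
      using \<phi> unfolding mem_eigenspace_iff[where w = w, OF w] by blast+
    obtain c where c: "\<And>x. (\<phi> \<circ> orbit_proj) x = (\<Sum>k\<in>?K. Re (c k * character k x))"
      using lift_expansion[where w = w, OF w l] by blast
    have "\<phi> = (\<Sum>k\<in>?K. scale_fun (Re (c k)) (?c k) + scale_fun (- Im (c k)) (?s k))"
    proof
      fix x
      have "(\<Sum>k\<in>?K. scale_fun (Re (c k)) (?c k) + scale_fun (- Im (c k)) (?s k)) x =
          (\<Sum>k\<in>?K. Re (c k) * ?c k x + - Im (c k) * ?s k x)"
        using fin by (induction rule: finite_induct) auto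
      moreover have "\<phi> x = (\<Sum>k\<in>?K. Re (c k) * ?c k x + - Im (c k) * ?s k x)"
      proof (cases "x \<in> range orbit_proj")
        case True
        then have "\<phi> x = (\<phi> \<circ> orbit_proj) (section_of x)" by (simp add: orbit_proj_section)
        then show ?thesis unfolding c using True by (simp add: descend_def)
      qed (simp add: z descend_def)
      ultimately show "\<phi> x = (\<Sum>k\<in>?K. scale_fun (Re (c k)) (?c k) + scale_fun (- Im (c k)) (?s k)) x" by simp
    qed
    also have "\<dots> \<in> real_functions.span ?W"
      by (intro real_functions.span_sum real_functions.span_add real_functions.span_scale real_functions.span_base) auto
    finally show ?thesis .
  qed
  then show ?thesis using fin by (intro that[of ?W]) auto
qed

lemma dim_eigenspace_eq_0:
  assumes w: "\<And>i. 0 < w i" and "{k \<in> int_lattice. wave_form w k = \<mu>} = {}"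
  shows "real_functions.dim (eigenspace orbifold_of (weight_metric w) \<mu>) = 0"
proof -
  obtain W where "eigenspace orbifold_of (weight_metric w) \<mu> \<subseteq> real_functions.span W" "W = {}"
    using eigenspace_finite_span[where w = w and \<mu> = \<mu>, OF w] assms(2) by metis
  then show ?thesis using real_functions.dim_le_card[of _ W] by fastforce
qed

lemma discrete_spectrum:
  assumes w: "\<And>i. 0 < w i"
  shows "finite {\<mu>. 0 < \<mu> \<and> \<mu> \<le> C \<and> real_functions.dim (eigenspace orbifold_of (weight_metric w) \<mu>) \<noteq> 0}"
proof (rule finite_subset[OF _ finite_imageI[OF finite_wave_form_le[where w = w and C = C, OF w]]])
  show "{\<mu>. 0 < \<mu> \<and> \<mu> \<le> C \<and> real_functions.dim (eigenspace orbifold_of (weight_metric w) \<mu>) \<noteq> 0}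
      \<subseteq> wave_form w ` {k \<in> int_lattice. wave_form w k \<le> C}"
  proof
    fix \<mu> assume \<mu>: "\<mu> \<in> {\<mu>. 0 < \<mu> \<and> \<mu> \<le> C \<and> real_functions.dim (eigenspace orbifold_of (weight_metric w) \<mu>) \<noteq> 0}"
    then obtain k where "k \<in> int_lattice" "wave_form w k = \<mu>" using dim_eigenspace_eq_0[where w = w and \<mu> = \<mu>, OF w] by auto
    then show "\<mu> \<in> wave_form w ` {k \<in> int_lattice. wave_form w k \<le> C}" using \<mu> by auto
  qed
qed

text \<open>The function \<open>cos (j x)\<close> of a coordinate \<open>x\<close> that no group element reverses descends to the quotient.\<close>

lemma dim_eigenspace_square:
  fixes j :: nat
  assumes w: "\<And>i. 0 < w i" and ax: "w ax = 1" "\<And>s. s \<in> S \<Longrightarrow> s $ ax = 1"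
  shows "1 \<le> real_functions.dim (eigenspace orbifold_of (weight_metric w) ((real j)\<^sup>2))"
proof -
  let ?F = "\<lambda>x::real^'n. 1 * cos (real j * x $ ax) + 0 * sin (real j * x $ ax)"
  have "?F \<in> lifts w ((real j)\<^sup>2)"
    unfolding lifts_def
  proof (intro CollectI conjI allI ballI)
    show "smooth_on UNIV ?F" by (rule smooth_on_trig)
    fix x
    have "w i * partial_deriv i (partial_deriv i ?F) x = (if i = ax then - (real j)\<^sup>2 * ?F x else 0)" for i
      unfolding smooth_on_trig(2) by (simp add: ax power2_eq_square)
    then show "- (\<Sum>i\<in>UNIV. w i * partial_deriv i (partial_deriv i ?F) x) = (real j)\<^sup>2 * ?F x" by simp
  next
    fix s v x :: "real^'n" assume s: "s \<in> S" and v: "v \<in> int_lattice"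
    obtain n where "v $ ax = of_int n" using v unfolding int_lattice_def by (auto elim: Ints_cases)
    then have "real j * ((2 * pi) *\<^sub>R v + s * x) $ ax = real j * x $ ax + 2 * pi * of_int (int j * n)"
      using ax(2)[OF s] by (simp add: algebra_simps)
    moreover have "cos (real j * x $ ax + 2 * pi * of_int (int j * n)) = cos (real j * x $ ax)"
      using sin_cos_eq_iff by blast
    ultimately show "?F ((2 * pi) *\<^sub>R v + s * x) = ?F x" by simp
  qed
  note D = descend_mem_eigenspace[where w = w, OF w this]
  obtain W where W: "finite W" "eigenspace orbifold_of (weight_metric w) ((real j)\<^sup>2) \<subseteq> real_functions.span W"
    by (rule eigenspace_finite_span[where w = w and \<mu> = "(real j)\<^sup>2", OF w]) (rule that)
  have "(descend ?F \<circ> orbit_proj) 0 = 1" unfolding D(2) by simp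
  then have "descend ?F \<noteq> 0" by auto
  then show ?thesis using dim_pos[OF W(2,1) D(1)] by simp
qed

lemma unbounded_spectrum:
  assumes w: "\<And>i. 0 < w i" and ax: "w ax = 1" "\<And>s. s \<in> S \<Longrightarrow> s $ ax = 1"
  shows "k \<le> spectral_count (\<lambda>\<mu>. real_functions.dim (eigenspace orbifold_of (weight_metric w) \<mu>)) ((real k)\<^sup>2)"
  by (intro le_spectral_count_squares discrete_spectrum w dim_eigenspace_square[where w = w and ax = ax, OF w ax])

lemma eigenvalue_eq_spectral_list:
  assumes w: "\<And>i. 0 < w i" and ax: "w ax = 1" "\<And>s. s \<in> S \<Longrightarrow> s $ ax = 1"
  shows "eigenvalue k orbifold_of (weight_metric w) =
    spectral_list (\<lambda>\<mu>. real_functions.dim (eigenspace orbifold_of (weight_metric w) \<mu>)) k"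
proof (rule eigenvalue_eq, rule eigenvalue_sequence_spectral_list)
  fix \<mu> :: real assume "\<mu> < 0"
  have "0 \<le> wave_form w k" for k
    unfolding wave_form_def using w by (intro sum_nonneg) (simp add: less_imp_le)
  then have "wave_form w k \<noteq> \<mu>" for k using \<open>\<mu> < 0\<close> by (metis not_le)
  then have "{k \<in> int_lattice. wave_form w k = \<mu>} = {}" by simp
  then show "real_functions.dim (eigenspace orbifold_of (weight_metric w) \<mu>) = 0"
    by (rule dim_eigenspace_eq_0[OF w])
next
  show "\<exists>C. k \<le> spectral_count (\<lambda>\<mu>. real_functions.dim (eigenspace orbifold_of (weight_metric w) \<mu>)) C" for k
    using unbounded_spectrum[where w = w and ax = ax, OF w ax] by blast
qed (rule discrete_spectrum[where w = w, OF w])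

end

section \<open>The torus and the pillow orbifold\<close>

interpretation torus: flat_orbifold "{1}" "torus_map :: real^'n::finite \<Rightarrow> complex^'n"
  by unfold_locales (auto simp: torus_map_eq_iff add.commute intro: continuous_torus_map)

lemma (in flat_orbifold) is_manifold:
  assumes "S = {1}"
  shows "is_manifold orbifold_of"
  unfolding is_manifold_def
proof (intro conjI ballI is_orbifold)
  fix c assume "c \<in> atlas orbifold_of"
  then obtain a r where c: "c = chart a r" by auto
  have "fixing a = {1}" using fixing_one fixing_S assms by blast
  then show "grp c = {\<one>\<^bsub>BijGroup (cover c)\<^esub>}" unfolding c using rotation_one by simp
qed

lemma (in flat_orbifold) singular_points:
  assumes s: "s \<in> S" "s \<noteq> 1"
  shows "singular_points orbifold_of \<noteq> {}"
proof -
  obtain i where i: "s $ i = - 1" using s S_sign[OF s(1)] by (auto simp: vec_eq_iff)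
  obtain r where r: "good 0 r" using ex_good by blast
  then have r0: "0 < r" by (simp add: good_def)
  have "s \<in> fixing 0" unfolding fixing_def using s(1) int_lattice_0 by (auto intro!: bexI[of _ 0])
  then have mem: "rotation 0 r s \<in> isotropy (chart 0 r) 0"
    unfolding isotropy_def using r0 by auto
  let ?x = "(r / 2) *\<^sub>R axis i 1 :: real^'n"
  have "?x \<in> ball 0 r" using r0 norm_Basis[of "axis i 1 :: real^'n"] by (simp add: axis_in_Basis_iff)
  moreover have "(s * ?x) $ i \<noteq> ?x $ i" using i r0 by (simp add: axis_def)
  then have "s * ?x \<noteq> ?x" by metis
  ultimately have "rotation 0 r s ?x \<noteq> \<one>\<^bsub>BijGroup (ball 0 r)\<^esub> ?x" by (simp add: BijGroup_def)
  then have "rotation 0 r s \<noteq> \<one>\<^bsub>BijGroup (ball 0 r)\<^esub>" by metis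
  then have "isotropy (chart 0 r) 0 \<noteq> {\<one>\<^bsub>BijGroup (cover (chart 0 r))\<^esub>}"
    using mem by (metis chart_simps(1) singletonD)
  moreover have "0 \<in> cover (chart 0 r)" using r0 by simp
  moreover have "chart 0 r \<in> atlas orbifold_of" using r by auto
  ultimately have "orbit_proj 0 \<in> singular_points orbifold_of"
    unfolding singular_points_def using chart_simps(2)[of 0 r] by (metis (mono_tags, lifting) mem_Collect_eq)
  then show ?thesis by blast
qed

definition half_turn :: "'n \<Rightarrow> 'n \<Rightarrow> real^'n::finite" where
  "half_turn p q = (\<chi> i. if i = p \<or> i = q then - 1 else 1)"

text \<open>The half turn reverses the coordinates \<open>p\<close> and \<open>q\<close>. Invariant functions on the torus in these
  coordinates are the two cosines and the product of the sines, and together they separate the orbits.\<close>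

definition pillow_map :: "'n \<Rightarrow> 'n \<Rightarrow> real^'n::finite \<Rightarrow> complex^'n" where
  "pillow_map p q x = (\<chi> i. if i = p then Complex (cos (x $ p)) (sin (x $ p) * sin (x $ q))
     else if i = q then of_real (cos (x $ q)) else cis (x $ i))"

lemma pillow_map_half_turn: "p \<noteq> q \<Longrightarrow> pillow_map p q (half_turn p q * x) = pillow_map p q x"
  by (simp add: pillow_map_def half_turn_def vec_eq_iff)

lemma pillow_map_torus_map:
  assumes "torus_map x = torus_map y"
  shows "pillow_map p q x = pillow_map p q y"
proof -
  have "cis (x $ i) = cis (y $ i)" for i using assms by (simp add: torus_map_def vec_eq_iff)
  then have "cos (x $ i) = cos (y $ i)" "sin (x $ i) = sin (y $ i)" for i by (simp_all add: complex_eq_iff)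
  then show ?thesis by (simp add: pillow_map_def vec_eq_iff complex_eq_iff)
qed

text \<open>Equal cosines determine the sines up to sign, and equal products force the two signs to agree, unless one of
  the sines vanishes and its sign is immaterial.\<close>

lemma pillow_map_separates:
  assumes pq: "p \<noteq> q" and eq: "pillow_map p q x = pillow_map p q y"
  shows "torus_map x = torus_map y \<or> torus_map (half_turn p q * x) = torus_map y"
proof -
  have comp: "pillow_map p q x $ i = pillow_map p q y $ i" for i using eq by simp
  have p: "cos (x $ p) = cos (y $ p)" "sin (x $ p) * sin (x $ q) = sin (y $ p) * sin (y $ q)"
    using comp[of p] by (simp_all add: pillow_map_def)
  have q: "cos (x $ q) = cos (y $ q)" using comp[of q] pq by (simp add: pillow_map_def)
  have o: "cis (x $ i) = cis (y $ i)" if "i \<noteq> p" "i \<noteq> q" for i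
    using comp[of i] that by (simp add: pillow_map_def)
  have sq: "\<bar>sin a\<bar> = \<bar>sin b\<bar>" if "cos a = cos b" for a b :: real
  proof -
    have "(sin a)\<^sup>2 = (sin b)\<^sup>2" using that sin_squared_eq[of a] sin_squared_eq[of b] by simp
    then show ?thesis by (simp add: power2_eq_iff abs_eq_iff)
  qed
  have "sin (x $ p) = sin (y $ p) \<and> sin (x $ q) = sin (y $ q) \<or>
      - sin (x $ p) = sin (y $ p) \<and> - sin (x $ q) = sin (y $ q)"
    using sq[OF p(1)] sq[OF q] p(2) by (auto simp: abs_if split: if_splits)
  then show ?thesis
  proof
    assume "sin (x $ p) = sin (y $ p) \<and> sin (x $ q) = sin (y $ q)"
    then have "cis (x $ i) = cis (y $ i)" for i
      using o[of i] p(1) q by (cases "i = p"; cases "i = q") (simp_all add: complex_eq_iff)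
    then show ?thesis by (simp add: torus_map_def vec_eq_iff)
  next
    assume "- sin (x $ p) = sin (y $ p) \<and> - sin (x $ q) = sin (y $ q)"
    then have "cis ((half_turn p q * x) $ i) = cis (y $ i)" for i
      using o[of i] p(1) q by (cases "i = p"; cases "i = q") (simp_all add: complex_eq_iff half_turn_def)
    then show ?thesis by (simp add: torus_map_def vec_eq_iff)
  qed
qed

lemma flat_orbifold_half_turn:
  assumes pq: "p \<noteq> q"
  shows "flat_orbifold {1, half_turn p q :: real^'n::finite} (pillow_map p q)"
proof
  let ?\<rho> = "half_turn p q :: real^'n"
  have sq: "?\<rho> * ?\<rho> = 1" by (simp add: half_turn_def vec_eq_iff)
  show "s $ i = 1 \<or> s $ i = - 1" if "s \<in> {1, ?\<rho>}" for s i using that by (auto simp: half_turn_def)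
  show "1 \<in> {1, ?\<rho>}" by simp
  show "s * t \<in> {1, ?\<rho>}" if "s \<in> {1, ?\<rho>}" "t \<in> {1, ?\<rho>}" for s t using that sq by auto
  show "(\<Prod>i\<in>UNIV. s $ i) = 1" if "s \<in> {1, ?\<rho>}" for s
  proof -
    have "(\<Prod>i\<in>UNIV. ?\<rho> $ i) = (\<Prod>i\<in>{p, q}. ?\<rho> $ i)"
      by (rule prod.mono_neutral_right) (auto simp: half_turn_def)
    then have "(\<Prod>i\<in>UNIV. ?\<rho> $ i) = 1" using pq by (simp add: half_turn_def)
    then show ?thesis using that by auto
  qed
  show "continuous_on A (pillow_map p q)" for A :: "(real^'n) set"
  proof -
    have "continuous_on A (\<lambda>x::real^'n. if i = p then Complex (cos (x $ p)) (sin (x $ p) * sin (x $ q))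
       else if i = q then of_real (cos (x $ q)) else cis (x $ i))" for i
      unfolding Complex_eq cis_conv_exp
      by (cases "i = p"; cases "i = q") (auto intro!: continuous_intros)
    then show ?thesis unfolding pillow_map_def[abs_def] by (rule continuous_on_vec_lambda)
  qed
  fix x y :: "real^'n"
  show "pillow_map p q x = pillow_map p q y \<longleftrightarrow>
      (\<exists>s\<in>{1, ?\<rho>}. \<exists>v\<in>int_lattice. y = (2 * pi) *\<^sub>R v + s * x)"
  proof
    assume "pillow_map p q x = pillow_map p q y"
    then have "torus_map x = torus_map y \<or> torus_map (?\<rho> * x) = torus_map y"
      by (rule pillow_map_separates[OF pq])
    then show "\<exists>s\<in>{1, ?\<rho>}. \<exists>v\<in>int_lattice. y = (2 * pi) *\<^sub>R v + s * x"
      unfolding torus_map_eq_iff by (auto simp: add.commute)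
  next
    assume "\<exists>s\<in>{1, ?\<rho>}. \<exists>v\<in>int_lattice. y = (2 * pi) *\<^sub>R v + s * x"
    then obtain s v where s: "s \<in> {1, ?\<rho>}" and "v \<in> int_lattice" "y = (2 * pi) *\<^sub>R v + s * x"
      by blast
    then have v: "v \<in> int_lattice" "y = s * x + (2 * pi) *\<^sub>R v" by (simp_all add: add.commute)
    have "torus_map (s * x) = torus_map y" unfolding torus_map_eq_iff using v by blast
    then have "pillow_map p q y = pillow_map p q (s * x)" using pillow_map_torus_map by metis
    also have "\<dots> = pillow_map p q x" using s pillow_map_half_turn[OF pq] by auto
    finally show "pillow_map p q x = pillow_map p q y" by simp
  qed
qed

lemma (in flat_orbifold) linear_descend_lift:
  "Vector_Spaces.linear scale_fun scale_fun (\<lambda>\<phi> :: 'a \<Rightarrow> real. descend (\<phi> \<circ> f))"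
  unfolding Vector_Spaces.linear_iff by (auto simp: vector_space_scale_fun descend_def fun_eq_iff)

text \<open>If \<open>S\<close> fixes every frequency \<open>k\<close> that contributes to \<open>\<mu>\<close>, then every eigenfunction of the torus for \<open>\<mu>\<close> is
  invariant under \<open>S\<close>. So the lifts are the same, and passing to the lift and down again is an
  isomorphism of the eigenspaces.\<close>

lemma (in flat_orbifold) dim_eigenspace_eq_torus:
  assumes w: "\<And>i. 0 < w i"
    and inv: "\<And>k s. k \<in> int_lattice \<Longrightarrow> wave_form w k = \<mu> \<Longrightarrow> s \<in> S \<Longrightarrow> s * k = k"
  shows "real_functions.dim (eigenspace torus.orbifold_of (weight_metric w) \<mu>)
    = real_functions.dim (eigenspace orbifold_of (weight_metric w) \<mu>)"
proof -
  have lifts_eq: "lifts w \<mu> = torus.lifts w \<mu>"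
  proof (intro equalityI subsetI)
    fix F assume F: "F \<in> lifts w \<mu>"
    have "F ((2 * pi) *\<^sub>R v + 1 * x) = F x" if "v \<in> int_lattice" for v x
      using F S_one that unfolding lifts_def by blast
    then show "F \<in> torus.lifts w \<mu>" using F unfolding lifts_def torus.lifts_def by simp
  next
    fix F assume F: "F \<in> torus.lifts w \<mu>"
    obtain c where c: "\<And>x. F x = (\<Sum>k\<in>{k \<in> int_lattice. wave_form w k = \<mu>}. Re (c k * character k x))"
      by (rule torus.lift_expansion[where w = w, OF w F]) (rule that)
    have "F ((2 * pi) *\<^sub>R v + s * x) = F x" if "s \<in> S" "v \<in> int_lattice" for s v x
    proof -
      have "F ((2 * pi) *\<^sub>R v + 1 * (s * x)) = F (s * x)"
        using F that(2) unfolding torus.lifts_def by blast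
      moreover have "character k (s * x) = character k x" if "k \<in> int_lattice" "wave_form w k = \<mu>" for k
      proof -
        have "k \<bullet> (s * x) = (s * k) \<bullet> x" by (simp add: inner_vec_def mult_ac)
        then show ?thesis using inv[OF that \<open>s \<in> S\<close>] by (simp add: character_def)
      qed
      then have "F (s * x) = F x" unfolding c by (intro sum.cong) auto
      ultimately show ?thesis by simp
    qed
    then show "F \<in> lifts w \<mu>" using F unfolding lifts_def torus.lifts_def by simp
  qed
  let ?A = "eigenspace torus.orbifold_of (weight_metric w) \<mu>"
    and ?B = "eigenspace orbifold_of (weight_metric w) \<mu>"
  let ?T = "\<lambda>\<phi>. descend (\<phi> \<circ> torus.orbit_proj)" and ?T' = "\<lambda>\<psi>. torus.descend (\<psi> \<circ> orbit_proj)"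
  have A: "(\<forall>x. x \<notin> range (torus.orbit_proj :: real^'n \<Rightarrow> real) \<longrightarrow> \<phi> x = 0) \<and> \<phi> \<circ> torus.orbit_proj \<in> lifts w \<mu>" if "\<phi> \<in> ?A" for \<phi>
    using that unfolding torus.mem_eigenspace_iff[where w = w, OF w] lifts_eq by auto
  have B: "(\<forall>x. x \<notin> range orbit_proj \<longrightarrow> \<psi> x = 0) \<and> \<psi> \<circ> orbit_proj \<in> torus.lifts w \<mu>" if "\<psi> \<in> ?B" for \<psi>
    using that unfolding mem_eigenspace_iff[where w = w, OF w] lifts_eq[symmetric] by auto
  show ?thesis
  proof (rule dim_eq_of_inverse_linear_maps[where T = ?T and T' = ?T'])
    show "Vector_Spaces.linear scale_fun scale_fun ?T" by (rule linear_descend_lift)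
    show "Vector_Spaces.linear scale_fun scale_fun ?T'" by (rule torus.linear_descend_lift)
    fix \<phi> assume \<phi>: "\<phi> \<in> ?A"
    show "?T \<phi> \<in> ?B" by (rule descend_mem_eigenspace(1)[where w = w, OF w]) (use A[OF \<phi>] in blast)
    have "?T \<phi> \<circ> orbit_proj = \<phi> \<circ> torus.orbit_proj"
      by (rule descend_mem_eigenspace(2)[where w = w, OF w]) (use A[OF \<phi>] in blast)
    moreover have "torus.descend (\<phi> \<circ> (torus.orbit_proj :: real^'n \<Rightarrow> real)) = \<phi>"
      by (rule torus.descend_lift) (use A[OF \<phi>] in blast)
    ultimately show "?T' (?T \<phi>) = \<phi>" by simp
  next
    fix \<psi> assume \<psi>: "\<psi> \<in> ?B"
    show "?T' \<psi> \<in> ?A" by (rule torus.descend_mem_eigenspace(1)[where w = w, OF w]) (use B[OF \<psi>] in blast)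
    have "?T' \<psi> \<circ> torus.orbit_proj = \<psi> \<circ> orbit_proj"
      by (rule torus.descend_mem_eigenspace(2)[where w = w, OF w]) (use B[OF \<psi>] in blast)
    moreover have "descend (\<psi> \<circ> orbit_proj) = \<psi>"
      by (rule descend_lift) (use B[OF \<psi>] in blast)
    ultimately show "?T (?T' \<psi>) = \<psi>" by simp
  qed
qed

theorem theorem8p5:
  fixes N m :: nat
  assumes "N > 0" and "m \<ge> 2" and "CARD('n::finite) = 2 * m"
  shows "\<exists>(Orb :: nat \<Rightarrow> (real, 'n) orbifold) (h :: nat \<Rightarrow> (real, 'n) metric)
          (M :: (real, 'n) orbifold) (g :: nat \<Rightarrow> (real, 'n) metric).
     (\<forall>l\<ge>1. closed_orbifold (Orb l) \<and> oriented (Orb l) \<and> singular_points (Orb l) \<noteq> {} \<and>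
             riemannian_metric (Orb l) (h l)) \<and>
     closed_orbifold M \<and> oriented M \<and> is_manifold M \<and>
     (\<forall>l\<ge>1. riemannian_metric M (g l)) \<and>
     (\<forall>l\<ge>1. \<forall>k\<le>N. \<bar>eigenvalue k (Orb l) (h l) - eigenvalue k M (g l)\<bar> < 1 / real l) \<and>
     (\<exists>p\<in>points M. \<exists>g\<^sub>0. riemannian_metric_on M (points M - {p}) g\<^sub>0 \<and>
        (\<forall>c\<in>atlas M. \<forall>u\<in>cover c. proj c u \<noteq> p \<longrightarrow> (\<lambda>l. g l c u) \<longlonglongrightarrow> g\<^sub>0 c u))"
proof -
  have ex: "\<exists>x. x \<notin> A" if "card A < CARD('n)" for A :: "'n set"
    using that by (metis UNIV_eq_I order_less_irrefl)
  obtain p :: 'n where True by blast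
  obtain q where "q \<noteq> p" using ex[of "{p}"] assms by auto
  then have q: "p \<noteq> q" by simp
  obtain r where r: "r \<noteq> p" "r \<noteq> q" using ex[of "{p, q}"] assms q by auto
  interpret pillow: flat_orbifold "{1, half_turn p q}" "pillow_map p q"
    by (rule flat_orbifold_half_turn[OF q])
  \<comment> \<open>Direction \<open>r\<close> is the long one. In the others the weight exceeds \<open>N\<^sup>2\<close>, so a nonzero integer
    frequency there already gives an eigenvalue above \<open>N\<^sup>2\<close>.\<close>
  define w :: "'n \<Rightarrow> real" where "w i = (if i = r then 1 else (real N)\<^sup>2 + 1)" for i
  have w: "0 < w i" for i by (simp add: w_def add_nonneg_pos)
  have wr: "w r = 1" by (simp add: w_def)
  have ht_r: "s $ r = 1" if "s \<in> {1, half_turn p q}" for s using that r by (auto simp: half_turn_def)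
  let ?G = "weight_metric w"
  have G: "0 < (\<chi> i. 1 / w i) $ i" for i using w by simp

  have low: "half_turn p q * k = k"
    if k: "k \<in> int_lattice" "wave_form w k \<le> (real N)\<^sup>2" for k
  proof -
    have "k $ i = 0" if i: "i \<noteq> r" for i
    proof -
      obtain n where n: "k $ i = of_int n" using k(1) unfolding int_lattice_def by (auto elim: Ints_cases)
      have "w i * (k $ i)\<^sup>2 \<le> wave_form w k"
        unfolding wave_form_def using w by (intro member_le_sum) (auto simp: less_imp_le)
      then have "w i * (k $ i)\<^sup>2 < w i * 1" using k(2) i by (simp add: w_def)
      then have "(k $ i)\<^sup>2 < 1" using w[of i] mult_less_cancel_left_pos by blast
      then have "\<bar>real_of_int n\<bar> < 1" unfolding n by (simp add: abs_square_less_1)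
      then have "n = 0" by linarith
      then show ?thesis unfolding n by simp
    qed
    then show ?thesis using r by (auto simp: half_turn_def vec_eq_iff)
  qed
  let ?dM = "\<lambda>\<mu>. real_functions.dim (eigenspace torus.orbifold_of ?G \<mu>)"
    and ?dO = "\<lambda>\<mu>. real_functions.dim (eigenspace pillow.orbifold_of ?G \<mu>)"
  have dim_eq: "?dM \<mu> = ?dO \<mu>" if "\<mu> \<le> (real N)\<^sup>2" for \<mu>
  proof (rule pillow.dim_eigenspace_eq_torus[where w = w, OF w])
    show "s * k = k" if "k \<in> int_lattice" "wave_form w k = \<mu>" "s \<in> {1, half_turn p q}" for k s
      using that low[of k] \<open>\<mu> \<le> (real N)\<^sup>2\<close> by auto
  qed
  have one_r: "s $ r = 1" if "s \<in> {1}" for s :: "real^'n" using that by simp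
  have ev: "eigenvalue k pillow.orbifold_of ?G = eigenvalue k torus.orbifold_of ?G" if "k \<le> N" for k
  proof -
    have "spectral_list ?dM k = spectral_list ?dO k"
    proof (rule spectral_list_cong[where C = "(real N)\<^sup>2"])
      show "?dM \<mu> = ?dO \<mu>" if "0 < \<mu>" "\<mu> \<le> (real N)\<^sup>2" for \<mu> by (rule dim_eq[OF that(2)])
      show "finite {\<mu>. 0 < \<mu> \<and> \<mu> \<le> C \<and> ?dM \<mu> \<noteq> 0}" for C
        by (rule torus.discrete_spectrum[where w = w, OF w])
      show "finite {\<mu>. 0 < \<mu> \<and> \<mu> \<le> C \<and> ?dO \<mu> \<noteq> 0}" for C
        by (rule pillow.discrete_spectrum[where w = w, OF w])
      show "\<exists>C. j \<le> spectral_count ?dM C" for j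
        using torus.unbounded_spectrum[where w = w and ax = r, OF w wr one_r] by blast
      show "\<exists>C. j \<le> spectral_count ?dO C" for j
        using pillow.unbounded_spectrum[where w = w and ax = r, OF w wr ht_r] by blast
      show "0 < (real N)\<^sup>2" using assms(1) by simp
      show "k \<le> spectral_count ?dM ((real N)\<^sup>2)"
        using torus.unbounded_spectrum[where w = w and ax = r, OF w wr one_r] that order_trans by blast
    qed
    moreover have "eigenvalue k torus.orbifold_of ?G = spectral_list ?dM k"
      by (rule torus.eigenvalue_eq_spectral_list[where w = w and ax = r, OF w wr one_r])
    moreover have "eigenvalue k pillow.orbifold_of ?G = spectral_list ?dO k"
      by (rule pillow.eigenvalue_eq_spectral_list[where w = w and ax = r, OF w wr ht_r])
    ultimately show ?thesis by (simp only:)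
  qed
  have "half_turn p q $ p \<noteq> (1 :: real^'n) $ p" by (simp add: half_turn_def)
  then have ht: "half_turn p q \<noteq> (1 :: real^'n)" by metis
  show ?thesis
  proof (rule exI[of _ "\<lambda>_. pillow.orbifold_of"], rule exI[of _ "\<lambda>_. ?G"],
      rule exI[of _ torus.orbifold_of], rule exI[of _ "\<lambda>_. ?G"], intro conjI allI impI)
    show "closed_orbifold pillow.orbifold_of" by (rule pillow.closed_orbifold)
    show "oriented pillow.orbifold_of" by (rule pillow.oriented)
    show "singular_points pillow.orbifold_of \<noteq> {}" using pillow.singular_points[of "half_turn p q"] ht by simp
    show "riemannian_metric pillow.orbifold_of ?G" by (rule pillow.flat_metric[OF G])
    show "closed_orbifold torus.orbifold_of" by (rule torus.closed_orbifold)
    show "oriented torus.orbifold_of" by (rule torus.oriented)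
    show "is_manifold torus.orbifold_of" by (rule torus.is_manifold[OF refl])
    show "riemannian_metric torus.orbifold_of ?G" by (rule torus.flat_metric[OF G])
    show "\<bar>eigenvalue k pillow.orbifold_of ?G - eigenvalue k torus.orbifold_of ?G\<bar> < 1 / real l"
      if "1 \<le> l" "k \<le> N" for l k
      using that ev[OF that(2)] by simp
    let ?p = "torus.orbit_proj (0 :: real^'n)" and ?M = "torus.orbifold_of :: (real, 'n) orbifold"
    have "?p \<in> points ?M" by (simp add: torus.topspace_orbit_space)
    moreover have "riemannian_metric_on ?M (points ?M - {?p}) ?G" by (rule torus.flat_metric[OF G])
    ultimately show "\<exists>p\<in>points ?M. \<exists>g\<^sub>0. riemannian_metric_on ?M (points ?M - {p}) g\<^sub>0 \<and>
        (\<forall>c\<in>atlas ?M. \<forall>u\<in>cover c. proj c u \<noteq> p \<longrightarrow> (\<lambda>l. ?G c u) \<longlonglongrightarrow> g\<^sub>0 c u)"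
      by (intro bexI[of _ ?p] exI[of _ ?G] conjI ballI impI tendsto_const)
  qed
qed

end
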